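(* For every $t\ge 0$ and every $\mathbf{z}=(z_1,\dots,z_J)\in\mathcal{D}$, the occupancy vector $\mathbf{N}(t)=(N_1(t),\dots,N_J(t))$ of the network satisfies $$\phi_t(\mathbf{z}):=\mathbb{E}\Big[\prod_{j=1}^J z_j^{N_j(t)}\Big]=\exp\Big\{-\int_0^t\lambda(\tau)\Big[1-G_{\mathbf{S}}\Big(1+\sum_{k=1}^J(z_k-1)q^1_k(t-\tau),\ \dots,\ 1+\sum_{k=1}^J(z_k-1)q^J_k(t-\tau)\Big)\Big]\,d\tau\Big\}.$$
   Context: Consider an open network of $J$ infinite server queues, indexed $1,\dots,J$, empty at time $0$. Batches arrive at the points $T_1,T_2,\dots$ of a non-homogeneous Poisson process on $[0,\infty)$ with rate $\lambda(t)$, where $\Lambda(t)=\int_0^t\lambda(\tau)\,d\tau<\infty$ for all $t$. At time $T_i$, $\Sigma_{ij}$ customers arrive at queue $j$, for $j=1,\dots,J$. The vectors $\mathbf{\Sigma}_i=(\Sigma_{i1},\dots,\Sigma_{iJ})$ are independent random vectors with non-negative integer components, all with the same distribution as a generic vector $\mathbf{S}=(S_1,\dots,S_J)$ having multivariate probability generating function $G_{\mathbf{S}}(z_1,\dots,z_J)=\mathbb{E}\big[\prod_{j=1}^J z_j^{S_j}\big]$, defined on a subset $\mathcal{D}\subseteq\mathbb{C}^J$ that contains the $J$-dimensional unit polydisc $\{|z_j|\le 1 \text{ for all } j\}$. The $\ell$th customer entering queue $j$ at time $T_i$ is marked with a stochastic process $X^j_{i,\ell}(t)$, $t\ge 0$,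 where $X^j_{i,\ell}(t)=k\in\{1,\dots,J\}$ if the customer is in queue $k$ at time $T_i+t$; customers may leave the network, so $\sum_{k=1}^J q^j_k(t)\le 1$ for the probabilities $q^j_k(t)$ given next. For each $i$ and $\ell=1,\dots,\Sigma_{ij}$, the processes $X^j_{i,\ell}$ are selected independently with a law such that $P(X^j_{i,\ell}(t)=k)=q^j_k(t)$; the routes of customers through the network are mutually independent, conditional on the node of entry. $N_k(t)$ is the number of customers in queue $k$ at time $t$.
   Formalization: For z in D outside the unit polydisc the identity is asserted only when the expectation φ_t(z) exists (it can fail to exist for z in D); existence is proved on the polydisc. Routes are assumed jointly measurable in time and outcome, so that N(t) is a random variable. *)

theory Defs
  imports "HOL-Probability.Probability"
begin

definition generated_algebra :: "'a set \<Rightarrow> 'i set \<Rightarrow> ('i \<Rightarrow> 'a \<Rightarrow> 'b) \<Rightarrow> 'b measure \<Rightarrow> 'a measure" where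
  "generated_algebra \<Omega> I Y N = sigma \<Omega> (\<Union>i\<in>I. {Y i -` A \<inter> \<Omega> | A. A \<in> sets N})"

text \<open>Points are enumerated by the naturals; the value \<open>\<infinity>\<close> stands for a point that does not exist,
  since there are only finitely many points when the total intensity is finite. The enumeration
  need not be increasing.\<close>

definition num_points :: "(nat \<Rightarrow> 'a \<Rightarrow> ereal) \<Rightarrow> real set \<Rightarrow> 'a \<Rightarrow> nat" where
  "num_points T B \<omega> = card {i. T i \<omega> \<in> ereal ` B}"

text \<open>The finiteness clause is needed because \<^const>\<open>card\<close> is \<open>0\<close> on infinite sets. The Poisson
  probabilities are written out because \<^const>\<open>poisson_pmf\<close> excludes mean \<open>0\<close>. In the
  independence clause, all but finitely many of the sets may be empty.\<close>

locale poisson_points = prob_space M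
  for M :: "'a measure" and rate :: "real \<Rightarrow> real" and T :: "nat \<Rightarrow> 'a \<Rightarrow> ereal" +
  assumes rate_nonneg: "\<And>\<tau>. 0 \<le> \<tau> \<Longrightarrow> 0 \<le> rate \<tau>"
    and rate_integrable: "\<And>t. set_integrable lborel {0..t} rate"
    and points_measurable: "\<And>i. T i \<in> borel_measurable M"
    and points_nonneg: "\<And>i \<omega>. \<omega> \<in> space M \<Longrightarrow> 0 \<le> T i \<omega>"
    and points_locally_finite: "\<And>t::real. AE \<omega> in M. finite {i. T i \<omega> \<le> ereal t}"
    and num_points_poisson:
      "\<And>B n. \<lbrakk>B \<in> sets borel; bounded B; B \<subseteq> {0..}\<rbrakk> \<Longrightarrow>
        prob {\<omega> \<in> space M. num_points T B \<omega> = n} =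
          (LBINT \<tau>:B. rate \<tau>) ^ n / fact n * exp (- (LBINT \<tau>:B. rate \<tau>))"
    and num_points_indep:
      "\<And>B :: nat \<Rightarrow> real set.
        \<lbrakk>\<And>m. B m \<in> sets borel; \<And>m. bounded (B m); \<And>m. B m \<subseteq> {0..}; disjoint_family B\<rbrakk> \<Longrightarrow>
        indep_vars (\<lambda>_. count_space UNIV) (\<lambda>m. num_points T (B m)) UNIV"

text \<open>The queues are the elements of the finite type \<open>'n\<close>, so \<open>J = CARD('n)\<close>.\<close>

definition pgf :: "(nat ^ 'n) pmf \<Rightarrow> complex ^ 'n \<Rightarrow> complex" where
  "pgf S z = measure_pmf.expectation S (\<lambda>s. \<Prod>j\<in>UNIV. (z $ j) ^ (s $ j))"

definition pgf_domain :: "(nat ^ 'n) pmf \<Rightarrow> (complex ^ 'n) set" where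
  "pgf_domain S = {z. integrable (measure_pmf S) (\<lambda>s. \<Prod>j\<in>UNIV. (z $ j) ^ (s $ j))}"

definition unit_polydisc :: "(complex ^ 'n) set" where
  "unit_polydisc = {z. \<forall>j. norm (z $ j) \<le> 1}"

datatype 'n source = Arrivals | Batch nat | Route 'n nat nat

text \<open>\<open>batch i $ j\<close> customers enter queue \<open>j\<close> at time \<open>T i\<close>. The route \<open>X j i l\<close> is defined for every
  \<open>l\<close>, but only those with \<open>l < batch i $ j\<close> belong to actual customers. \<open>X j i l u \<omega>\<close> is \<open>Some k\<close> if the
  customer is in queue \<open>k\<close> at time \<open>T i + u\<close>, and \<open>None\<close> if he has left the network.

  Each route is assumed to be a measurable process with respect to the \<open>\<sigma>\<close>-algebra it generates
  (which holds e.g. for right-continuous paths). Measurability of each \<open>X j i l u\<close> alone would not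
  make the position at the random age \<open>t - T i\<close> a random variable. Joint measurability
  with respect to \<open>M\<close> only would not be compatible with independence: if \<open>U\<close> is uniformly
  distributed, the process \<open>\<lambda>u. (u = U)\<close> is independent of \<open>U\<close>, as it generates a trivial
  \<open>\<sigma>\<close>-algebra.\<close>

locale batch_network = poisson_points M rate T
  for M :: "'a measure" and rate :: "real \<Rightarrow> real" and T :: "nat \<Rightarrow> 'a \<Rightarrow> ereal" +
  fixes S :: "(nat ^ 'n) pmf"
    and batch :: "nat \<Rightarrow> 'a \<Rightarrow> nat ^ 'n"
    and X :: "'n \<Rightarrow> nat \<Rightarrow> nat \<Rightarrow> real \<Rightarrow> 'a \<Rightarrow> 'n option"
    and q :: "'n \<Rightarrow> 'n \<Rightarrow> real \<Rightarrow> real"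
  assumes batch_measurable: "\<And>i. batch i \<in> M \<rightarrow>\<^sub>M count_space UNIV"
    and batch_distr: "\<And>i. distr M (count_space UNIV) (batch i) = measure_pmf S"
    and route_measurable:
      "\<And>j i l. (\<lambda>(u, \<omega>). X j i l u \<omega>) \<in>
        restrict_space borel {0..} \<Otimes>\<^sub>M
          generated_algebra (space M) {0..} (X j i l) (count_space UNIV)
        \<rightarrow>\<^sub>M count_space UNIV"
    and route_prob:
      "\<And>j i l u k. 0 \<le> u \<Longrightarrow> prob {\<omega> \<in> space M. X j i l u \<omega> = Some k} = q j k u"
    and sources_indep:
      "indep_sets
        (\<lambda>s. case s of
            Arrivals \<Rightarrow> sets (generated_algebra (space M) UNIV T borel)
          | Batch i \<Rightarrow> sets (generated_algebra (space M) {i} batch (count_space UNIV))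
          | Route j i l \<Rightarrow> sets (generated_algebra (space M) {0..} (X j i l) (count_space UNIV)))
        UNIV"

definition occupancy ::
  "(nat \<Rightarrow> 'a \<Rightarrow> ereal) \<Rightarrow> (nat \<Rightarrow> 'a \<Rightarrow> nat ^ 'n) \<Rightarrow>
   ('n \<Rightarrow> nat \<Rightarrow> nat \<Rightarrow> real \<Rightarrow> 'a \<Rightarrow> 'n option) \<Rightarrow> real \<Rightarrow> 'a \<Rightarrow> nat ^ 'n" where
  "occupancy T batch X t \<omega> =
    (\<chi> k. card {(j, i, l). T i \<omega> \<le> ereal t \<and> l < batch i \<omega> $ j \<and>
                        X j i l (t - real_of_ereal (T i \<omega>)) \<omega> = Some k})"

definition mixed_arg :: "('n \<Rightarrow> 'n \<Rightarrow> real \<Rightarrow> real) \<Rightarrow> complex ^ 'n \<Rightarrow> real \<Rightarrow> complex ^ 'n" where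
  "mixed_arg q z u = (\<chi> j. 1 + (\<Sum>k\<in>UNIV. (z $ k - 1) * of_real (q j k u)))"

end

theory Submission
  imports Defs
begin

text \<open>Given the arrival epochs and the batch sizes, the customers move independently, and a customer who
entered queue \<open>j\<close> a time \<open>u\<close> ago contributes to the product \<open>\<Prod>\<^sub>k z\<^sub>k ^ N\<^sub>k(t)\<close> a factor with mean
\<open>1 + \<Sum>\<^sub>k (z\<^sub>k - 1) q j k u\<close>. Averaging over the batch sizes turns the batch at \<open>T\<^sub>i\<close> into a factor
\<open>h(T\<^sub>i)\<close>, where \<open>h(\<tau>)\<close> is the generating function of a batch at \<open>mixed_arg q z (t - \<tau>)\<close>. What remains
is the probability generating functional of a Poisson process,
\<open>E \<Prod> h(T\<^sub>i) = exp (\<integral> \<lambda> (h - 1))\<close>.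

The two averaging steps are applications of Fubini's theorem to independent random elements. These
elements are copies of the identity map of the probability space, one for each source of randomness,
each with the \<open>\<sigma>\<close>-algebra of its source as target; they are independent by \<open>source_indep\<close>. The first step
separates the routes from everything else (\<open>routes_indep\<close>, \<open>customer_product_route_integral\<close>), the
second one the batch sizes from the arrival epochs (\<open>batches_indep\<close>, \<open>batch_product_integral\<close>). The
generating functional (\<open>point_product_integral\<close>) is the product formula for independent Poisson
variables when \<open>h\<close> is simple, and is obtained for general \<open>h\<close> by approximation.

If some \<open>\<bar>z\<^sub>k\<bar>\<close> exceeds \<open>1\<close>, integrability is at issue. Replacing every \<open>z\<^sub>k\<close> by its modulus makes all
integrands non-negative, so that both averaging steps are equations in \<open>[0, \<infinity>]\<close>
(\<open>customer_product_nn_integral\<close>), and the expectation is that of a product over Poisson points of an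
\<open>[0, \<infinity>]\<close>-valued function \<open>g\<close>. If it is finite, then \<open>\<integral> \<lambda> g\<close> is finite
(\<open>set_nn_integral_rate_finite\<close>). Since \<open>g\<close> dominates the modulus of \<open>h\<close>, this yields at once that the
arguments lie in the domain of the generating function almost everywhere with respect to the
intensity, that the exponent exists, and that the complex calculation is legitimate.\<close>

section \<open>Random counts and random products\<close>

lemma measurable_card_countable:
  fixes S :: "'a \<Rightarrow> 'i::countable set"
  assumes S: "\<And>i. {x \<in> space M. i \<in> S x} \<in> sets M"
  shows "(\<lambda>x. card (S x)) \<in> M \<rightarrow>\<^sub>M count_space UNIV"
proof -
  have "{x \<in> space M. n \<in> to_nat ` S x} \<in> sets M" for n
  proof (cases "n \<in> range (to_nat :: 'i \<Rightarrow> nat)")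
    case True
    then obtain i :: 'i where "n = to_nat i" by auto
    then have "{x \<in> space M. n \<in> to_nat ` S x} = {x \<in> space M. i \<in> S x}"
      by auto
    then show ?thesis using S by simp
  next
    case False
    then have "{x \<in> space M. n \<in> to_nat ` S x} = {}" by auto
    then show ?thesis by (simp only: sets.empty_sets)
  qed
  then have "(\<lambda>x. card (to_nat ` S x)) \<in> M \<rightarrow>\<^sub>M count_space UNIV"
    by (rule measurable_card)
  moreover have "card (to_nat ` S x) = card (S x)" for x
    by (rule card_image) (simp add: inj_on_def)
  ultimately show ?thesis by simp
qed

text \<open>On the event that the index set is finite, the product is the limit of its partial products, which
are eventually constant. Elsewhere it is \<open>1\<close>, the value of a product over an infinite set.\<close>

lemma borel_measurable_prod_random_index:
  fixes f :: "nat \<Rightarrow> 'a \<Rightarrow> 'b::{real_normed_field, banach, second_countable_topology}"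
  assumes f[measurable]: "\<And>i. f i \<in> borel_measurable M"
    and S[measurable]: "\<And>i. {x \<in> space M. i \<in> S x} \<in> sets M"
  shows "(\<lambda>x. \<Prod>i\<in>S x. f i x) \<in> borel_measurable M"
proof -
  have "(\<Prod>i\<in>S x. f i x) =
      (if finite (S x) then lim (\<lambda>n. \<Prod>i<n. if i \<in> S x then f i x else 1) else 1)" for x
  proof (cases "finite (S x)")
    case True
    then obtain m where m: "S x \<subseteq> {..<m}"
      using finite_nat_bounded by blast
    have "(\<Prod>i<n. if i \<in> S x then f i x else 1) = (\<Prod>i\<in>S x. f i x)" if "n \<ge> m" for n
      using m that by (intro prod.mono_neutral_cong_right) auto
    then have "(\<lambda>n. \<Prod>i<n. if i \<in> S x then f i x else 1) \<longlonglongrightarrow> (\<Prod>i\<in>S x. f i x)"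
      by (intro tendsto_eventually) (auto simp: eventually_sequentially)
    then show ?thesis using True by (simp add: limI)
  qed simp
  moreover have "(\<lambda>x. if finite (S x) then lim (\<lambda>n. \<Prod>i<n. if i \<in> S x then f i x else 1) else 1)
      \<in> borel_measurable M"
    by measurable
  ultimately show ?thesis by simp
qed

text \<open>Both sides group the elements of \<open>A\<close> by their position: this converts occupancy counts into a product
with one factor per customer.\<close>

lemma prod_case_option_eq_prod_power:
  fixes z :: "'n::finite \<Rightarrow> 'b::comm_monoid_mult"
  assumes "finite A"
  shows "(\<Prod>a\<in>A. case x a of None \<Rightarrow> 1 | Some k \<Rightarrow> z k) =
    (\<Prod>k\<in>UNIV. z k ^ card {a \<in> A. x a = Some k})"
  using assms
proof (induction A)
  case (insert b A)
  have "(\<Prod>k\<in>UNIV. z k ^ card {a \<in> insert b A. x a = Some k}) =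
      (\<Prod>k\<in>UNIV. (if x b = Some k then z k else 1) * z k ^ card {a \<in> A. x a = Some k})"
  proof (rule prod.cong[OF refl])
    fix k
    have "{a \<in> insert b A. x a = Some k} =
        (if x b = Some k then insert b {a \<in> A. x a = Some k} else {a \<in> A. x a = Some k})"
      by auto
    then show "z k ^ card {a \<in> insert b A. x a = Some k} =
        (if x b = Some k then z k else 1) * z k ^ card {a \<in> A. x a = Some k}"
      using insert by simp
  qed
  also have "\<dots> = (case x b of None \<Rightarrow> 1 | Some k \<Rightarrow> z k) *
      (\<Prod>k\<in>UNIV. z k ^ card {a \<in> A. x a = Some k})"
    by (simp add: prod.distrib split: option.split)
  finally show ?case using insert by simp
qed simp

section \<open>Integrals of functions of independent variables\<close>

text \<open>The joint law of independent \<open>X\<close> and \<open>Y\<close> is a product measure, so this is Tonelli's theorem, transported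
back to the original space.\<close>

lemma (in prob_space) indep_var_nn_integral:
  assumes ind: "indep_var N1 X N2 Y" and f[measurable]: "f \<in> borel_measurable (N1 \<Otimes>\<^sub>M N2)"
  shows "(\<integral>\<^sup>+\<omega>. f (X \<omega>, Y \<omega>) \<partial>M) = (\<integral>\<^sup>+\<omega>. \<integral>\<^sup>+\<omega>'. f (X \<omega>, Y \<omega>') \<partial>M \<partial>M)"
proof -
  have X[measurable]: "X \<in> M \<rightarrow>\<^sub>M N1" and Y[measurable]: "Y \<in> M \<rightarrow>\<^sub>M N2"
    using ind by (blast dest: indep_var_rv1 indep_var_rv2)+
  interpret D1: prob_space "distr M N1 X" by (rule prob_space_distr) simp
  interpret D2: prob_space "distr M N2 Y" by (rule prob_space_distr) simp
  have "(\<integral>\<^sup>+\<omega>. f (X \<omega>, Y \<omega>) \<partial>M) = integral\<^sup>N (distr M (N1 \<Otimes>\<^sub>M N2) (\<lambda>x. (X x, Y x))) f"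
    by (simp add: nn_integral_distr)
  also have "\<dots> = integral\<^sup>N (distr M N1 X \<Otimes>\<^sub>M distr M N2 Y) f"
    using ind by (simp add: indep_var_distribution_eq)
  also have "\<dots> = (\<integral>\<^sup>+x. \<integral>\<^sup>+y. f (x, y) \<partial>distr M N2 Y \<partial>distr M N1 X)"
    by (intro D2.nn_integral_fst[symmetric]) simp
  also have "\<dots> = (\<integral>\<^sup>+\<omega>. \<integral>\<^sup>+\<omega>'. f (X \<omega>, Y \<omega>') \<partial>M \<partial>M)"
    by (subst nn_integral_distr[OF X], simp)
      (intro nn_integral_cong nn_integral_distr, auto simp: measurable_space[OF X])
  finally show ?thesis .
qed

lemma (in prob_space) indep_var_integral:
  fixes f :: "'b \<times> 'b \<Rightarrow> 'd::{banach, second_countable_topology}"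
  assumes ind: "indep_var N1 X N2 Y" and f[measurable]: "f \<in> borel_measurable (N1 \<Otimes>\<^sub>M N2)"
    and int: "integrable M (\<lambda>\<omega>. f (X \<omega>, Y \<omega>))"
  shows "integrable M (\<lambda>\<omega>. LINT \<omega>'|M. f (X \<omega>, Y \<omega>'))"
    and "(LINT \<omega>|M. f (X \<omega>, Y \<omega>)) = (LINT \<omega>|M. LINT \<omega>'|M. f (X \<omega>, Y \<omega>'))"
proof -
  have X[measurable]: "X \<in> M \<rightarrow>\<^sub>M N1" and Y[measurable]: "Y \<in> M \<rightarrow>\<^sub>M N2"
    using ind by (blast dest: indep_var_rv1 indep_var_rv2)+
  interpret D1: prob_space "distr M N1 X" by (rule prob_space_distr) simp
  interpret D2: prob_space "distr M N2 Y" by (rule prob_space_distr) simp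
  interpret D: pair_prob_space "distr M N1 X" "distr M N2 Y" ..
  have eq: "distr M (N1 \<Otimes>\<^sub>M N2) (\<lambda>x. (X x, Y x)) = distr M N1 X \<Otimes>\<^sub>M distr M N2 Y"
    using ind by (simp add: indep_var_distribution_eq)
  have "integrable (distr M (N1 \<Otimes>\<^sub>M N2) (\<lambda>x. (X x, Y x))) f"
    using int by (simp add: integrable_distr_eq)
  then have int': "integrable (distr M N1 X \<Otimes>\<^sub>M distr M N2 Y) f"
    by (simp add: eq)
  have inner: "(LINT y|distr M N2 Y. f (X \<omega>, y)) = (LINT \<omega>'|M. f (X \<omega>, Y \<omega>'))"
    if "\<omega> \<in> space M" for \<omega>
    using measurable_space[OF X that] by (intro integral_distr[OF Y]) simp
  have "integrable M (\<lambda>\<omega>. LINT y|distr M N2 Y. f (X \<omega>, y))"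
    using D.integrable_fst'[OF int'] by (rule integrable_distr[OF X])
  then show "integrable M (\<lambda>\<omega>. LINT \<omega>'|M. f (X \<omega>, Y \<omega>'))"
    by (simp add: inner cong: Bochner_Integration.integrable_cong)
  have "(LINT \<omega>|M. f (X \<omega>, Y \<omega>)) = integral\<^sup>L (distr M (N1 \<Otimes>\<^sub>M N2) (\<lambda>x. (X x, Y x))) f"
    by (simp add: integral_distr)
  also have "\<dots> = integral\<^sup>L (distr M N1 X \<Otimes>\<^sub>M distr M N2 Y) f"
    by (simp add: eq)
  also have "\<dots> = (LINT x|distr M N1 X. LINT y|distr M N2 Y. f (x, y))"
    by (rule D.integral_fst'[OF int', symmetric])
  also have "\<dots> = (LINT \<omega>|M. LINT y|distr M N2 Y. f (X \<omega>, y))"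
    by (rule integral_distr[OF X]) simp
  also have "\<dots> = (LINT \<omega>|M. LINT \<omega>'|M. f (X \<omega>, Y \<omega>'))"
    by (intro Bochner_Integration.integral_cong refl inner)
  finally show "(LINT \<omega>|M. f (X \<omega>, Y \<omega>)) = (LINT \<omega>|M. LINT \<omega>'|M. f (X \<omega>, Y \<omega>'))" .
qed

text \<open>A reindexed family is a regrouping into singleton groups.\<close>

lemma (in prob_space) indep_vars_reindex:
  assumes ind: "indep_vars N X I" and \<sigma>: "inj_on \<sigma> L" "\<sigma> ` L \<subseteq> I"
  shows "indep_vars (\<lambda>j. N (\<sigma> j)) (\<lambda>j. X (\<sigma> j)) L"
proof -
  have "indep_vars (\<lambda>j. PiM {\<sigma> j} N) (\<lambda>j \<omega>. restrict (\<lambda>i. X i \<omega>) {\<sigma> j}) L"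
    using \<sigma> by (intro indep_vars_restrict[OF ind]) (auto simp: disjoint_family_on_def inj_on_def)
  then have "indep_vars (\<lambda>j. N (\<sigma> j)) (\<lambda>j \<omega>. (restrict (\<lambda>i. X i \<omega>) {\<sigma> j}) (\<sigma> j)) L"
    by (rule indep_vars_compose2) (auto intro: measurable_component_singleton)
  then show ?thesis by simp
qed

section \<open>The generating functional of a Poisson process\<close>

context poisson_points
begin

text \<open>This is \<open>1\<close> on the null event that there are infinitely many points up to time \<open>t\<close>, which keeps it
measurable on the whole probability space.\<close>

definition point_product :: "(real \<Rightarrow> 'b::comm_monoid_mult) \<Rightarrow> real \<Rightarrow> 'a \<Rightarrow> 'b" where
  "point_product f t \<omega> = (\<Prod>i\<in>{i. T i \<omega> \<le> ereal t}. f (real_of_ereal (T i \<omega>)))"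

lemma rate_integrable_on:
  assumes "B \<in> sets borel" "B \<subseteq> {0..t}"
  shows "set_integrable lborel B rate"
  using assms by (intro set_integrable_subset[OF rate_integrable[of t]]) auto

lemma intensity_nonneg:
  assumes "B \<subseteq> {0..}"
  shows "0 \<le> (LBINT \<tau>:B. rate \<tau>)"
  unfolding set_lebesgue_integral_def
  using assms rate_nonneg by (intro integral_nonneg_AE) (auto simp: indicator_def)

text \<open>Measurability is part of the assumed independence of counts, here for the family consisting of \<open>B\<close> and
empty sets.\<close>

lemma num_points_measurable:
  assumes "B \<in> sets borel" "bounded B" "B \<subseteq> {0..}"
  shows "num_points T B \<in> M \<rightarrow>\<^sub>M count_space UNIV"
proof -
  have "indep_vars (\<lambda>_. count_space UNIV) (\<lambda>m::nat. num_points T (if m = 0 then B else {})) UNIV"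
    using assms by (intro num_points_indep) (auto simp: disjoint_family_on_def)
  then have "num_points T (if (0::nat) = 0 then B else {}) \<in> M \<rightarrow>\<^sub>M count_space UNIV"
    unfolding indep_vars_def2 by blast
  then show ?thesis by simp
qed

text \<open>The generating function of the Poisson law. The law is written as a density with respect to
counting measure, which covers a mean of \<open>0\<close> as well.\<close>

lemma power_num_points_integral:
  fixes c :: complex
  assumes B: "B \<in> sets borel" "bounded B" "B \<subseteq> {0..}"
  shows "has_bochner_integral M (\<lambda>\<omega>. c ^ num_points T B \<omega>)
    (exp (of_real (LBINT \<tau>:B. rate \<tau>) * (c - 1)))"
proof -
  define \<Lambda> where "\<Lambda> = (LBINT \<tau>:B. rate \<tau>)"
  define p where "p n = \<Lambda> ^ n / fact n * exp (- \<Lambda>)" for n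
  have \<Lambda>: "0 \<le> \<Lambda>" unfolding \<Lambda>_def by (rule intensity_nonneg[OF B(3)])
  then have p: "0 \<le> p n" for n unfolding p_def by simp
  note N[measurable] = num_points_measurable[OF B]
  have distr: "distr M (count_space UNIV) (num_points T B) = density (count_space UNIV) (\<lambda>n. ennreal (p n))"
  proof (rule measure_eqI_countable[of _ UNIV])
    fix n :: nat
    have "emeasure (distr M (count_space UNIV) (num_points T B)) {n} =
        emeasure M {\<omega> \<in> space M. num_points T B \<omega> = n}"
      by (subst emeasure_distr) (auto intro!: arg_cong2[where f=emeasure])
    also have "\<dots> = ennreal (p n)"
      unfolding emeasure_eq_measure num_points_poisson[OF B] p_def \<Lambda>_def ..
    also have "\<dots> = emeasure (density (count_space UNIV) (\<lambda>n. ennreal (p n))) {n}"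
      by (subst emeasure_density) (simp_all add: nn_integral_count_space_indicator[symmetric])
    finally show "emeasure (distr M (count_space UNIV) (num_points T B)) {n} =
        emeasure (density (count_space UNIV) (\<lambda>n. ennreal (p n))) {n}" .
  qed auto
  \<comment> \<open>Stated for every \<open>c\<close>, since absolute convergence follows from the instance at \<open>norm c\<close>.\<close>
  have sums: "(\<lambda>n. p n *\<^sub>R c ^ n) sums (exp (of_real \<Lambda> * (c - 1)))" for c :: complex
  proof -
    have "(\<lambda>n. exp (- of_real \<Lambda>) * ((of_real \<Lambda> * c) ^ n /\<^sub>R fact n)) sums
        (exp (- of_real \<Lambda>) * exp (of_real \<Lambda> * c))"
      by (intro sums_mult exp_converges)
    moreover have "exp (- of_real \<Lambda>) * exp (of_real \<Lambda> * c) = exp (of_real \<Lambda> * (c - 1))"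
      by (simp add: exp_add[symmetric] algebra_simps)
    moreover have "exp (- of_real \<Lambda>) * ((of_real \<Lambda> * c) ^ n /\<^sub>R fact n) = p n *\<^sub>R c ^ n" for n
      by (simp add: p_def scaleR_conv_of_real power_mult_distrib divide_simps exp_of_real[symmetric])
    ultimately show ?thesis by simp
  qed
  have "summable (\<lambda>n. norm (p n *\<^sub>R c ^ n))"
  proof -
    have "summable (\<lambda>n. p n *\<^sub>R (complex_of_real (norm c)) ^ n)"
      using sums by (rule sums_summable)
    then have "summable (\<lambda>n. Re (p n *\<^sub>R (complex_of_real (norm c)) ^ n))"
      by (rule summable_Re)
    moreover have "Re (p n *\<^sub>R (complex_of_real (norm c)) ^ n) = norm (p n *\<^sub>R c ^ n)" for n
      using p[of n] by (simp add: norm_power flip: of_real_power)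
    ultimately show ?thesis by simp
  qed
  then have int: "integrable (count_space UNIV) (\<lambda>n. p n *\<^sub>R c ^ n)"
    by (simp add: integrable_count_space_nat_iff)
  have "integrable (distr M (count_space UNIV) (num_points T B)) (\<lambda>n. c ^ n)"
    unfolding distr using int p by (subst integrable_density) auto
  then have 1: "integrable M (\<lambda>\<omega>. c ^ num_points T B \<omega>)"
    by (subst (asm) integrable_distr_eq) auto
  have "(LINT \<omega>|M. c ^ num_points T B \<omega>) =
      integral\<^sup>L (distr M (count_space UNIV) (num_points T B)) (\<lambda>n. c ^ n)"
    by (subst integral_distr) auto
  also have "\<dots> = integral\<^sup>L (count_space UNIV) (\<lambda>n. p n *\<^sub>R c ^ n)"
    unfolding distr using p by (subst integral_density) auto
  also have "\<dots> = exp (of_real \<Lambda> * (c - 1))"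
    using integral_count_space_nat[OF int] sums_unique[OF sums] by simp
  finally show ?thesis
    using 1 by (simp add: has_bochner_integral_iff \<Lambda>_def)
qed

lemma point_product_measurable:
  fixes f :: "real \<Rightarrow> 'b::{real_normed_field, banach, second_countable_topology}"
  assumes [measurable]: "f \<in> borel_measurable borel"
  shows "point_product f t \<in> borel_measurable M"
proof -
  note points_measurable[measurable]
  show ?thesis
    unfolding point_product_def[abs_def]
    by (rule borel_measurable_prod_random_index) measurable
qed

lemma point_product_eq_prod_powers:
  assumes t: "0 \<le> t" and \<omega>: "\<omega> \<in> space M" and fin: "finite {i. T i \<omega> \<le> ereal t}"
    and V: "finite V" "range f \<subseteq> V"
  shows "point_product f t \<omega> = (\<Prod>v\<in>V. v ^ num_points T (f -` {v} \<inter> {0..t}) \<omega>)"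
proof -
  let ?I = "{i. T i \<omega> \<le> ereal t}"
  let ?x = "\<lambda>i. real_of_ereal (T i \<omega>)"
  have T_iff: "T i \<omega> \<in> ereal ` B \<longleftrightarrow> T i \<omega> \<le> ereal t \<and> ?x i \<in> B" if "B \<subseteq> {0..t}" for i B
    using that points_nonneg[OF \<omega>, of i] by (cases "T i \<omega>") auto
  have x: "?x i \<in> {0..t}" if "i \<in> ?I" for i
    using that points_nonneg[OF \<omega>, of i] t by (cases "T i \<omega>") auto
  have "point_product f t \<omega> = (\<Prod>v\<in>V. \<Prod>i\<in>{i \<in> ?I. f (?x i) = v}. f (?x i))"
    unfolding point_product_def using V fin by (intro prod.group[symmetric]) auto
  also have "\<dots> = (\<Prod>v\<in>V. v ^ card {i \<in> ?I. f (?x i) = v})"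
    by (intro prod.cong refl) simp
  also have "\<dots> = (\<Prod>v\<in>V. v ^ num_points T (f -` {v} \<inter> {0..t}) \<omega>)"
  proof (intro prod.cong refl)
    fix v
    have "{i \<in> ?I. f (?x i) = v} = {i. T i \<omega> \<in> ereal ` (f -` {v} \<inter> {0..t})}"
      using x by (subst T_iff) auto
    then show "v ^ card {i \<in> ?I. f (?x i) = v} = v ^ num_points T (f -` {v} \<inter> {0..t}) \<omega>"
      unfolding num_points_def by simp
  qed
  finally show ?thesis .
qed

text \<open>The level sets of \<open>f\<close> in \<open>[0, t]\<close> contain independent Poisson numbers of points, and the product over
all points is the product of the values \<open>v\<close> raised to these numbers. So the expectation is
\<open>\<Prod>\<^sub>v exp (\<Lambda>(B\<^sub>v) (v - 1))\<close>, and the exponents add up to the integral of \<open>\<lambda> (f - 1)\<close>.\<close>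

lemma point_product_simple:
  fixes f :: "real \<Rightarrow> complex"
  assumes f: "simple_function borel f" and t: "0 \<le> t"
  shows "has_bochner_integral M (point_product f t)
    (exp (LBINT \<tau>:{0..t}. of_real (rate \<tau>) * (f \<tau> - 1)))"
proof -
  define V where "V = range f"
  define B where "B v = f -` {v} \<inter> {0..t}" for v
  define n where "n = card V"
  have fin: "finite V"
    using simple_functionD(1)[OF f] by (simp add: V_def)
  obtain e where e: "bij_betw e {..<n} V"
    using ex_bij_betw_nat_finite[OF fin] by (auto simp: n_def atLeast0LessThan)
  \<comment> \<open>Independence of counts is available for sequences of sets, so the finitely many level sets are
    enumerated and padded with empty sets.\<close>
  define B' where "B' m = (if m < n then B (e m) else {})" for m
  have B: "B v \<in> sets borel" "bounded (B v)" "B v \<subseteq> {0..}" "B v \<subseteq> {0..t}" for v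
    using simple_functionD(2)[OF f, of "{v}"]
    by (auto simp: B_def intro: bounded_subset[of "{0..t}"])
  have "disjoint_family B'"
    using e by (auto simp: disjoint_family_on_def B'_def B_def bij_betw_def inj_on_def)
  moreover have B': "B' m \<in> sets borel" "bounded (B' m)" "B' m \<subseteq> {0..}" for m
    using B by (auto simp: B'_def)
  ultimately have "indep_vars (\<lambda>_. count_space UNIV) (\<lambda>m. num_points T (B' m)) UNIV"
    by (intro num_points_indep)
  then have "indep_vars (\<lambda>_. count_space UNIV) (\<lambda>m. num_points T (B' m)) {..<n}"
    by (rule indep_vars_subset) simp
  then have "indep_vars (\<lambda>_. borel) (\<lambda>m \<omega>. e m ^ num_points T (B' m) \<omega>) {..<n}"
    by (rule indep_vars_compose2) simp
  moreover have bi: "has_bochner_integral M (\<lambda>\<omega>. e m ^ num_points T (B' m) \<omega>)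
      (exp (of_real (LBINT \<tau>:B' m. rate \<tau>) * (e m - 1)))" for m
    using B' by (intro power_num_points_integral)
  ultimately have "integrable M (\<lambda>\<omega>. \<Prod>m<n. e m ^ num_points T (B' m) \<omega>)"
    and "(LINT \<omega>|M. (\<Prod>m<n. e m ^ num_points T (B' m) \<omega>)) =
      (\<Prod>m<n. exp (of_real (LBINT \<tau>:B' m. rate \<tau>) * (e m - 1)))"
    by (auto intro!: indep_vars_integrable
        simp: indep_vars_lebesgue_integral has_bochner_integral_iff)
  moreover have "(\<Prod>m<n. e m ^ num_points T (B' m) \<omega>) = (\<Prod>v\<in>V. v ^ num_points T (B v) \<omega>)" for \<omega>
    using prod.reindex_bij_betw[OF e, of "\<lambda>v. v ^ num_points T (B v) \<omega>"]
    by (simp add: B'_def)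
  moreover have "(\<Prod>m<n. exp (of_real (LBINT \<tau>:B' m. rate \<tau>) * (e m - 1))) =
      (\<Prod>v\<in>V. exp (of_real (LBINT \<tau>:B v. rate \<tau>) * (v - 1)))"
    using prod.reindex_bij_betw[OF e, of "\<lambda>v. exp (of_real (LBINT \<tau>:B v. rate \<tau>) * (v - 1))"]
    by (simp add: B'_def)
  ultimately have powers: "has_bochner_integral M (\<lambda>\<omega>. \<Prod>v\<in>V. v ^ num_points T (B v) \<omega>)
      (\<Prod>v\<in>V. exp (of_real (LBINT \<tau>:B v. rate \<tau>) * (v - 1)))"
    by (simp add: has_bochner_integral_iff)
  have "(LBINT \<tau>:{0..t}. of_real (rate \<tau>) * (f \<tau> - 1)) =
      (LBINT \<tau>. (\<Sum>v\<in>V. complex_of_real (indicator (B v) \<tau> *\<^sub>R rate \<tau>) * (v - 1)))"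
    unfolding set_lebesgue_integral_def
  proof (intro Bochner_Integration.integral_cong refl)
    fix \<tau> :: real
    have "(\<Sum>v\<in>V. complex_of_real (indicator (B v) \<tau> *\<^sub>R rate \<tau>) * (v - 1)) =
        (\<Sum>v\<in>V. if v = f \<tau> then indicator {0..t} \<tau> *\<^sub>R (of_real (rate \<tau>) * (v - 1)) else 0)"
      by (intro sum.cong refl) (auto simp: B_def indicator_def)
    also have "\<dots> = indicator {0..t} \<tau> *\<^sub>R (of_real (rate \<tau>) * (f \<tau> - 1))"
      using fin by (simp add: V_def)
    finally show "indicator {0..t} \<tau> *\<^sub>R (of_real (rate \<tau>) * (f \<tau> - 1)) =
        (\<Sum>v\<in>V. complex_of_real (indicator (B v) \<tau> *\<^sub>R rate \<tau>) * (v - 1))" by simp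
  qed
  also have "\<dots> = (\<Sum>v\<in>V. of_real (LBINT \<tau>:B v. rate \<tau>) * (v - 1))"
    using rate_integrable_on[OF B(1,4)]
    unfolding set_lebesgue_integral_def set_integrable_def
    by (subst Bochner_Integration.integral_sum)
      (auto intro!: integrable_mult_left integrable_of_real sum.cong
        simp del: of_real_mult real_scaleR_def simp: integral_complex_of_real)
  finally have exponent: "exp (LBINT \<tau>:{0..t}. of_real (rate \<tau>) * (f \<tau> - 1)) =
      (\<Prod>v\<in>V. exp (of_real (LBINT \<tau>:B v. rate \<tau>) * (v - 1)))"
    using fin by (simp add: exp_sum)
  have "AE \<omega> in M. (\<Prod>v\<in>V. v ^ num_points T (B v) \<omega>) = point_product f t \<omega>"
    using points_locally_finite[of t] AE_space
  proof eventually_elim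
    case (elim \<omega>)
    then show ?case
      using point_product_eq_prod_powers[OF t, of \<omega> V f] fin by (simp add: V_def B_def)
  qed
  moreover have "point_product f t \<in> borel_measurable M"
    using f by (intro point_product_measurable borel_measurable_simple_function)
  ultimately show ?thesis
    using powers unfolding exponent
    by (subst has_bochner_integral_cong_AE[symmetric]) (auto simp: has_bochner_integral_iff)
qed

lemma rate_times_bounded_integrable:
  fixes f :: "real \<Rightarrow> 'b::{banach, second_countable_topology, real_normed_algebra_1}"
  assumes f[measurable]: "f \<in> borel_measurable borel" and bound: "\<And>\<tau>. norm (f \<tau>) \<le> c"
  shows "set_integrable lborel {0..t} (\<lambda>\<tau>. of_real (rate \<tau>) * f \<tau>)"
  unfolding set_integrable_def
proof (rule Bochner_Integration.integrable_bound)
  have i: "integrable lborel (\<lambda>\<tau>. indicator {0..t} \<tau> *\<^sub>R rate \<tau>)"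
    using rate_integrable[of t] by (simp add: set_integrable_def)
  then show "integrable lborel (\<lambda>\<tau>. (indicator {0..t} \<tau> *\<^sub>R rate \<tau>) * c)"
    by (rule integrable_mult_left)
  have [measurable]: "(\<lambda>\<tau>. indicator {0..t} \<tau> *\<^sub>R rate \<tau>) \<in> borel_measurable lborel"
    using i by (rule borel_measurable_integrable)
  have "(\<lambda>\<tau>. of_real (indicator {0..t} \<tau> *\<^sub>R rate \<tau>) * f \<tau>) \<in> borel_measurable lborel"
    by measurable
  moreover have "of_real (indicator {0..t} \<tau> *\<^sub>R rate \<tau>) * f \<tau> =
      indicator {0..t} \<tau> *\<^sub>R (of_real (rate \<tau>) * f \<tau>)" for \<tau>
    by (simp add: indicator_def)
  ultimately show "(\<lambda>\<tau>. indicator {0..t} \<tau> *\<^sub>R (of_real (rate \<tau>) * f \<tau>)) \<in> borel_measurable lborel"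
    by simp
  show "AE \<tau> in lborel. norm (indicator {0..t} \<tau> *\<^sub>R (of_real (rate \<tau>) * f \<tau>))
      \<le> norm ((indicator {0..t} \<tau> *\<^sub>R rate \<tau>) * c)"
  proof (intro AE_I2)
    fix \<tau>
    have "norm (of_real (rate \<tau>) * f \<tau>) \<le> norm (of_real (rate \<tau>) :: 'b) * norm (f \<tau>)"
      by (rule norm_mult_ineq)
    also have "\<dots> \<le> \<bar>rate \<tau>\<bar> * \<bar>c\<bar>"
      using bound[of \<tau>] by (simp add: mult_left_mono)
    finally show "norm (indicator {0..t} \<tau> *\<^sub>R (of_real (rate \<tau>) * f \<tau>))
      \<le> norm ((indicator {0..t} \<tau> *\<^sub>R rate \<tau>) * c)"
      by (simp add: indicator_def abs_mult)
  qed
qed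

lemma simple_function_bounded:
  fixes f :: "real \<Rightarrow> 'b::real_normed_vector"
  assumes "simple_function borel f"
  obtains c where "\<And>\<tau>. norm (f \<tau>) \<le> c"
proof -
  have "bounded (range f)"
    using simple_functionD(1)[OF assms] by (intro finite_imp_bounded) simp
  then show ?thesis using that unfolding bounded_iff by auto
qed

lemma point_product_simple_nn:
  assumes r: "simple_function borel r" and nn: "\<And>\<tau>. 0 \<le> r \<tau>" and t: "0 \<le> t"
  shows "(\<integral>\<^sup>+\<omega>. ennreal (point_product r t \<omega>) \<partial>M) =
    ennreal (exp ((LBINT \<tau>:{0..t}. rate \<tau> * r \<tau>) - (LBINT \<tau>:{0..t}. rate \<tau>)))"
proof -
  have bi: "has_bochner_integral M (point_product (\<lambda>\<tau>. complex_of_real (r \<tau>)) t)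
      (exp (LBINT \<tau>:{0..t}. of_real (rate \<tau>) * (complex_of_real (r \<tau>) - 1)))"
    by (intro point_product_simple t simple_function_compose1[OF r])
  have eq: "point_product (\<lambda>\<tau>. complex_of_real (r \<tau>)) t = (\<lambda>\<omega>. complex_of_real (point_product r t \<omega>))"
    by (simp add: point_product_def fun_eq_iff)
  have "(LBINT \<tau>:{0..t}. of_real (rate \<tau>) * (complex_of_real (r \<tau>) - 1)) =
      complex_of_real (LBINT \<tau>:{0..t}. rate \<tau> * (r \<tau> - 1))"
    by (subst set_integral_complex_of_real[symmetric]) simp
  with bi have "has_bochner_integral M (\<lambda>\<omega>. complex_of_real (point_product r t \<omega>))
      (complex_of_real (exp (LBINT \<tau>:{0..t}. rate \<tau> * (r \<tau> - 1))))"
    by (simp add: eq exp_of_real)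
  then have int: "integrable M (point_product r t)"
    and "integral\<^sup>L M (point_product r t) = exp (LBINT \<tau>:{0..t}. rate \<tau> * (r \<tau> - 1))"
    by (auto simp: has_bochner_integral_iff integral_complex_of_real complex_of_real_integrable_eq)
  moreover have "(\<integral>\<^sup>+\<omega>. ennreal (point_product r t \<omega>) \<partial>M) = integral\<^sup>L M (point_product r t)"
    using nn by (intro nn_integral_eq_integral int) (simp add: point_product_def prod_nonneg)
  moreover have "(LBINT \<tau>:{0..t}. rate \<tau> * (r \<tau> - 1)) =
      (LBINT \<tau>:{0..t}. rate \<tau> * r \<tau>) - (LBINT \<tau>:{0..t}. rate \<tau>)"
  proof -
    obtain c where c: "\<And>\<tau>. norm (r \<tau>) \<le> c"
      using simple_function_bounded[OF r] by blast
    then have "set_integrable lborel {0..t} (\<lambda>\<tau>. rate \<tau> * r \<tau>)"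
      using rate_times_bounded_integrable[of r c t] borel_measurable_simple_function[OF r] by simp
    then show ?thesis
      using rate_integrable[of t] by (simp add: right_diff_distrib set_integral_diff)
  qed
  ultimately show ?thesis by simp
qed

lemma set_nn_integral_rate_measurable:
  assumes [measurable]: "g \<in> borel_measurable borel"
  shows "(\<lambda>\<tau>. ennreal (rate \<tau>) * g \<tau> * indicator {0..t} \<tau>) \<in> borel_measurable lborel"
proof -
  have [measurable]: "(\<lambda>\<tau>. indicator {0..t} \<tau> *\<^sub>R rate \<tau>) \<in> borel_measurable lborel"
    using rate_integrable[of t] unfolding set_integrable_def by (rule borel_measurable_integrable)
  have "(\<lambda>\<tau>. ennreal (indicator {0..t} \<tau> *\<^sub>R rate \<tau>) * g \<tau>) \<in> borel_measurable lborel"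
    by measurable
  moreover have "ennreal (indicator {0..t} \<tau> *\<^sub>R rate \<tau>) * g \<tau> =
      ennreal (rate \<tau>) * g \<tau> * indicator {0..t} \<tau>" for \<tau>
    by (simp add: indicator_def)
  ultimately show ?thesis by simp
qed

lemma point_product_mono:
  fixes f g :: "real \<Rightarrow> ennreal"
  assumes "\<And>\<tau>. f \<tau> \<le> g \<tau>"
  shows "point_product f t \<omega> \<le> point_product g t \<omega>"
  unfolding point_product_def using assms by (intro prod_mono_ennreal)

lemma point_product_ennreal:
  assumes "\<And>\<tau>. 0 \<le> f \<tau>"
  shows "point_product (\<lambda>\<tau>. ennreal (f \<tau>)) t \<omega> = ennreal (point_product f t \<omega>)"
  unfolding point_product_def using assms by (intro prod_ennreal)

text \<open>A simple function \<open>u\<close> below \<open>g\<close> satisfies \<open>exp (\<integral> \<lambda> u - \<Lambda>) = E \<Prod> u(T\<^sub>i) \<le> E \<Prod> g(T\<^sub>i) = C\<close>, that is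
\<open>\<integral> \<lambda> u \<le> ln C + \<Lambda>\<close>. This bound does not depend on \<open>u\<close>, so it passes to \<open>g\<close> by monotone convergence.
Only monotonicity of products in \<open>[0, \<infinity>]\<close> enters, so values \<open>0\<close> and \<open>\<infinity>\<close> of \<open>g\<close> cause no difficulty.\<close>

lemma set_nn_integral_rate_finite:
  fixes g :: "real \<Rightarrow> ennreal"
  assumes g: "g \<in> borel_measurable borel" and t: "0 \<le> t"
    and fin: "(\<integral>\<^sup>+\<omega>. point_product g t \<omega> \<partial>M) < \<infinity>"
  shows "(\<integral>\<^sup>+\<tau>\<in>{0..t}. ennreal (rate \<tau>) * g \<tau> \<partial>lborel) < \<infinity>"
proof -
  define \<Lambda> where "\<Lambda> = (LBINT \<tau>:{0..t}. rate \<tau>)"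
  obtain u where u: "\<And>n. simple_function borel (u n)" "incseq u" "\<And>n \<tau>. u n \<tau> < top"
    "\<And>\<tau>. (SUP n. u n \<tau>) = g \<tau>"
    using borel_measurable_implies_simple_function_sequence'[OF g] by metis
  define r where "r n \<tau> = enn2real (u n \<tau>)" for n \<tau>
  have r: "simple_function borel (r n)" "0 \<le> r n \<tau>" "ennreal (r n \<tau>) = u n \<tau>" for n \<tau>
    using u(1,3) by (auto simp: r_def[abs_def] intro: simple_function_compose1)
  have ug: "u n \<tau> \<le> g \<tau>" for n \<tau>
    unfolding u(4)[symmetric] by (rule SUP_upper) simp
  obtain C where C: "(\<integral>\<^sup>+\<omega>. point_product g t \<omega> \<partial>M) = ennreal C" "0 \<le> C"
    using fin by (cases "(\<integral>\<^sup>+\<omega>. point_product g t \<omega> \<partial>M)") auto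
  have bound: "(\<integral>\<^sup>+\<tau>\<in>{0..t}. ennreal (rate \<tau>) * u n \<tau> \<partial>lborel) \<le> ennreal (ln C + \<Lambda>)" for n
  proof -
    have "ennreal (exp ((LBINT \<tau>:{0..t}. rate \<tau> * r n \<tau>) - \<Lambda>)) =
        (\<integral>\<^sup>+\<omega>. ennreal (point_product (r n) t \<omega>) \<partial>M)"
      using point_product_simple_nn[OF r(1,2) t] by (simp add: \<Lambda>_def)
    also have "\<dots> \<le> (\<integral>\<^sup>+\<omega>. point_product g t \<omega> \<partial>M)"
      using ug r by (intro nn_integral_mono)
        (auto simp: point_product_ennreal[symmetric] intro!: point_product_mono)
    finally have le: "exp ((LBINT \<tau>:{0..t}. rate \<tau> * r n \<tau>) - \<Lambda>) \<le> C"
      using C by (simp add: ennreal_le_iff)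
    then have "ln (exp ((LBINT \<tau>:{0..t}. rate \<tau> * r n \<tau>) - \<Lambda>)) \<le> ln C"
      by (intro ln_mono) (auto intro: less_le_trans[OF exp_gt_zero])
    then have "(LBINT \<tau>:{0..t}. rate \<tau> * r n \<tau>) \<le> ln C + \<Lambda>"
      by simp
    moreover have "(\<integral>\<^sup>+\<tau>\<in>{0..t}. ennreal (rate \<tau>) * u n \<tau> \<partial>lborel) =
        ennreal (LBINT \<tau>:{0..t}. rate \<tau> * r n \<tau>)"
    proof -
      obtain c where "\<And>\<tau>. norm (r n \<tau>) \<le> c"
        using simple_function_bounded[OF r(1)] by blast
      then have int: "integrable lborel (\<lambda>\<tau>. indicator {0..t} \<tau> *\<^sub>R (rate \<tau> * r n \<tau>))"
        using rate_times_bounded_integrable[of "r n" c t] borel_measurable_simple_function[OF r(1)]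
        by (simp add: set_integrable_def)
      have "(\<integral>\<^sup>+\<tau>\<in>{0..t}. ennreal (rate \<tau>) * u n \<tau> \<partial>lborel) =
          (\<integral>\<^sup>+\<tau>. ennreal (indicator {0..t} \<tau> *\<^sub>R (rate \<tau> * r n \<tau>)) \<partial>lborel)"
        using r(2) rate_nonneg
        by (intro nn_integral_cong) (auto simp: indicator_def ennreal_mult r(3))
      also have "\<dots> = ennreal (LBINT \<tau>:{0..t}. rate \<tau> * r n \<tau>)"
        unfolding set_lebesgue_integral_def using int rate_nonneg r(2)
        by (intro nn_integral_eq_integral) (auto simp: indicator_def)
      finally show ?thesis .
    qed
    ultimately show ?thesis by (simp add: ennreal_leI)
  qed
  have "(\<integral>\<^sup>+\<tau>\<in>{0..t}. ennreal (rate \<tau>) * g \<tau> \<partial>lborel) =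
      (\<integral>\<^sup>+\<tau>. (SUP n. ennreal (rate \<tau>) * u n \<tau> * indicator {0..t} \<tau>) \<partial>lborel)"
    unfolding u(4)[symmetric]
    by (intro nn_integral_cong) (simp add: SUP_mult_left_ennreal SUP_mult_right_ennreal)
  also have "\<dots> = (SUP n. \<integral>\<^sup>+\<tau>\<in>{0..t}. ennreal (rate \<tau>) * u n \<tau> \<partial>lborel)"
  proof (rule nn_integral_monotone_convergence_SUP)
    show "incseq (\<lambda>n \<tau>. ennreal (rate \<tau>) * u n \<tau> * indicator {0..t} \<tau>)"
      using u(2) by (auto simp: incseq_def le_fun_def intro!: mult_left_mono mult_right_mono)
    show "(\<lambda>\<tau>. ennreal (rate \<tau>) * u n \<tau> * indicator {0..t} \<tau>) \<in> borel_measurable lborel" for n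
      by (intro set_nn_integral_rate_measurable borel_measurable_simple_function u(1))
  qed
  also have "\<dots> \<le> ennreal (ln C + \<Lambda>)"
    by (intro SUP_least bound)
  also have "\<dots> < \<infinity>" by simp
  finally show ?thesis .
qed

lemma point_product_tendsto:
  fixes f :: "nat \<Rightarrow> real \<Rightarrow> 'b::real_normed_field"
  assumes "\<And>\<tau>. (\<lambda>n. f n \<tau>) \<longlonglongrightarrow> g \<tau>"
  shows "(\<lambda>n. point_product (f n) t \<omega>) \<longlonglongrightarrow> point_product g t \<omega>"
  unfolding point_product_def
  using assms by (cases "finite {i. T i \<omega> \<le> ereal t}") (auto intro!: tendsto_prod)

text \<open>This provides the dominating function for the complex case. The approximating simple functions need
not lie below \<open>g\<close>, but they are bounded by \<open>2 g\<close>, which bounds the expectations of their products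
uniformly; Fatou's lemma then applies.\<close>

lemma integrable_point_product_nn:
  fixes g :: "real \<Rightarrow> real"
  assumes g[measurable]: "g \<in> borel_measurable borel" and nn: "\<And>\<tau>. 0 \<le> g \<tau>" and t: "0 \<le> t"
    and int: "set_integrable lborel {0..t} (\<lambda>\<tau>. rate \<tau> * g \<tau>)"
  shows "integrable M (point_product g t)"
proof -
  note [measurable] = point_product_measurable
  obtain u where u: "\<And>n. simple_function borel (u n)" "\<And>\<tau>. (\<lambda>n. u n \<tau>) \<longlonglongrightarrow> g \<tau>"
    "\<And>n \<tau>. norm (u n \<tau>) \<le> 2 * norm (g \<tau>)"
    using borel_measurable_implies_sequence_metric[OF g, of 0] by auto
  define r where "r n \<tau> = norm (u n \<tau>)" for n \<tau>
  have r: "simple_function borel (r n)" "0 \<le> r n \<tau>" "r n \<tau> \<le> 2 * g \<tau>" for n \<tau>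
    using u(1) u(3)[of n \<tau>] nn[of \<tau>] by (auto simp: r_def[abs_def] intro: simple_function_compose1)
  have [measurable]: "r n \<in> borel_measurable borel" for n
    by (intro borel_measurable_simple_function r(1))
  have lim: "(\<lambda>n. r n \<tau>) \<longlonglongrightarrow> g \<tau>" for \<tau>
    using tendsto_norm[OF u(2)[of \<tau>]] nn[of \<tau>] by (simp add: r_def)
  define c where "c = 2 * (LBINT \<tau>:{0..t}. rate \<tau> * g \<tau>) - (LBINT \<tau>:{0..t}. rate \<tau>)"
  have bound: "(\<integral>\<^sup>+\<omega>. ennreal (point_product (r n) t \<omega>) \<partial>M) \<le> ennreal (exp c)" for n
  proof -
    obtain b where "\<And>\<tau>. norm (r n \<tau>) \<le> b"
      using simple_function_bounded[OF r(1)] by blast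
    then have int_r: "set_integrable lborel {0..t} (\<lambda>\<tau>. rate \<tau> * r n \<tau>)"
      using rate_times_bounded_integrable[of "r n" b t] by simp
    have "(LBINT \<tau>:{0..t}. rate \<tau> * r n \<tau>) \<le> (LBINT \<tau>:{0..t}. 2 * (rate \<tau> * g \<tau>))"
    proof (rule set_integral_mono[OF int_r])
      show "set_integrable lborel {0..t} (\<lambda>\<tau>. 2 * (rate \<tau> * g \<tau>))"
        using int by (rule set_integrable_mult_right)
      show "rate \<tau> * r n \<tau> \<le> 2 * (rate \<tau> * g \<tau>)" if "\<tau> \<in> {0..t}" for \<tau>
        using mult_left_mono[OF r(3) rate_nonneg[of \<tau>]] that by (simp add: mult.left_commute)
    qed
    then show ?thesis
      unfolding point_product_simple_nn[OF r(1,2) t] by (auto simp: c_def intro!: ennreal_leI)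
  qed
  have "(\<integral>\<^sup>+\<omega>. ennreal (point_product g t \<omega>) \<partial>M) =
      (\<integral>\<^sup>+\<omega>. liminf (\<lambda>n. ennreal (point_product (r n) t \<omega>)) \<partial>M)"
    using point_product_tendsto[OF lim]
    by (intro nn_integral_cong lim_imp_Liminf[symmetric] tendsto_ennrealI) auto
  also have "\<dots> \<le> liminf (\<lambda>n. \<integral>\<^sup>+\<omega>. ennreal (point_product (r n) t \<omega>) \<partial>M)"
    by (rule nn_integral_liminf) measurable
  also have "\<dots> \<le> liminf (\<lambda>n. ennreal (exp c))"
    by (intro Liminf_mono always_eventually allI bound)
  also have "\<dots> < \<infinity>"
    by (simp add: Liminf_const)
  finally show ?thesis
    using nn by (intro integrableI_nonneg) (auto simp: point_product_def prod_nonneg)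
qed

text \<open>Dominated convergence on both sides, from simple functions \<open>u\<^sub>n\<close> with \<open>\<bar>u\<^sub>n\<bar> \<le> 2 \<bar>h\<bar>\<close>: the products over
the points are dominated by the product of \<open>2 \<bar>h\<bar>\<close>, whose expectation is finite because \<open>\<lambda> \<bar>h\<bar>\<close> is
integrable.\<close>

lemma point_product_integral:
  fixes h :: "real \<Rightarrow> complex"
  assumes h[measurable]: "h \<in> borel_measurable borel" and t: "0 \<le> t"
    and int: "set_integrable lborel {0..t} (\<lambda>\<tau>. of_real (rate \<tau>) * h \<tau>)"
  shows "integrable M (point_product h t)"
    and "(LINT \<omega>|M. point_product h t \<omega>) =
      exp (LBINT \<tau>:{0..t}. of_real (rate \<tau>) * (h \<tau> - 1))"
proof -
  note [measurable] = point_product_measurable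
  obtain u where u: "\<And>n. simple_function borel (u n)" "\<And>\<tau>. (\<lambda>n. u n \<tau>) \<longlonglongrightarrow> h \<tau>"
    "\<And>n \<tau>. norm (u n \<tau>) \<le> 2 * norm (h \<tau>)"
    using borel_measurable_implies_sequence_metric[OF h, of 0] by auto
  have [measurable]: "u n \<in> borel_measurable borel" for n
    by (intro borel_measurable_simple_function u(1))
  have int_norm: "set_integrable lborel {0..t} (\<lambda>\<tau>. rate \<tau> * norm (h \<tau>))"
  proof -
    have "set_integrable lborel {0..t} (\<lambda>\<tau>. norm (of_real (rate \<tau>) * h \<tau>))"
      by (rule set_integrable_norm[OF int])
    then show ?thesis
      unfolding set_integrable_def
      by (rule Bochner_Integration.integrable_cong[THEN iffD1, rotated 2])
        (auto simp: norm_mult rate_nonneg indicator_def)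
  qed
  have dom: "integrable M (point_product (\<lambda>\<tau>. 2 * norm (h \<tau>)) t)"
  proof (rule integrable_point_product_nn)
    show "set_integrable lborel {0..t} (\<lambda>\<tau>. rate \<tau> * (2 * norm (h \<tau>)))"
      using set_integrable_mult_right[of 2, OF int_norm] by (simp add: ac_simps)
  qed (auto simp: t)
  have norm_le: "norm (point_product f t \<omega>) \<le> point_product (\<lambda>\<tau>. 2 * norm (h \<tau>)) t \<omega>"
    if "\<And>\<tau>. norm (f \<tau>) \<le> 2 * norm (h \<tau>)" for f :: "real \<Rightarrow> complex" and \<omega>
    unfolding point_product_def prod_norm[symmetric] using that by (intro prod_mono) auto
  have lim: "(\<lambda>n. point_product (u n) t \<omega>) \<longlonglongrightarrow> point_product h t \<omega>" for \<omega>
    by (rule point_product_tendsto) (rule u(2))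
  show "integrable M (point_product h t)"
    by (rule Bochner_Integration.integrable_bound[OF dom]) (auto intro!: order_trans[OF norm_le])
  have "(\<lambda>n. LINT \<omega>|M. point_product (u n) t \<omega>) \<longlonglongrightarrow> (LINT \<omega>|M. point_product h t \<omega>)"
    by (rule integral_dominated_convergence[OF _ _ dom]) (auto intro: lim norm_le u(3))
  moreover have "(LINT \<omega>|M. point_product (u n) t \<omega>) =
      exp (LBINT \<tau>:{0..t}. of_real (rate \<tau>) * (u n \<tau> - 1))" for n
    using point_product_simple[OF u(1) t] by (simp add: has_bochner_integral_iff)
  moreover have "(\<lambda>n. exp (LBINT \<tau>:{0..t}. of_real (rate \<tau>) * (u n \<tau> - 1))) \<longlonglongrightarrow>
      exp (LBINT \<tau>:{0..t}. of_real (rate \<tau>) * (h \<tau> - 1))"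
    unfolding set_lebesgue_integral_def
  proof (intro tendsto_exp integral_dominated_convergence)
    let ?w = "\<lambda>\<tau>. 2 * (indicator {0..t} \<tau> *\<^sub>R (rate \<tau> * norm (h \<tau>))) + indicator {0..t} \<tau> *\<^sub>R rate \<tau>"
    show "integrable lborel ?w"
      using int_norm rate_integrable[of t] unfolding set_integrable_def by auto
    have [measurable]: "(\<lambda>\<tau>. indicator {0..t} \<tau> *\<^sub>R rate \<tau>) \<in> borel_measurable lborel"
      using rate_integrable[of t] unfolding set_integrable_def by (rule borel_measurable_integrable)
    have meas: "(\<lambda>\<tau>. indicator {0..t} \<tau> *\<^sub>R (complex_of_real (rate \<tau>) * (f \<tau> - 1))) \<in> borel_measurable lborel"
      if [measurable]: "f \<in> borel_measurable borel" for f :: "real \<Rightarrow> complex"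
    proof -
      have "(\<lambda>\<tau>. complex_of_real (indicator {0..t} \<tau> *\<^sub>R rate \<tau>) * (f \<tau> - 1)) \<in> borel_measurable lborel"
        by measurable
      moreover have "complex_of_real (indicator {0..t} \<tau> *\<^sub>R rate \<tau>) * (f \<tau> - 1) =
          indicator {0..t} \<tau> *\<^sub>R (complex_of_real (rate \<tau>) * (f \<tau> - 1))" for \<tau>
        by (simp add: indicator_def)
      ultimately show ?thesis by simp
    qed
    show "(\<lambda>\<tau>. indicator {0..t} \<tau> *\<^sub>R (complex_of_real (rate \<tau>) * (h \<tau> - 1))) \<in> borel_measurable lborel"
      by (rule meas) simp
    show "(\<lambda>\<tau>. indicator {0..t} \<tau> *\<^sub>R (complex_of_real (rate \<tau>) * (u n \<tau> - 1))) \<in> borel_measurable lborel" for n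
      by (rule meas) simp
    show "AE \<tau> in lborel. (\<lambda>n. indicator {0..t} \<tau> *\<^sub>R (complex_of_real (rate \<tau>) * (u n \<tau> - 1)))
        \<longlonglongrightarrow> indicator {0..t} \<tau> *\<^sub>R (complex_of_real (rate \<tau>) * (h \<tau> - 1))"
      by (intro AE_I2 tendsto_intros u(2))
    show "AE \<tau> in lborel. norm (indicator {0..t} \<tau> *\<^sub>R (complex_of_real (rate \<tau>) * (u n \<tau> - 1))) \<le> ?w \<tau>" for n
    proof (intro AE_I2)
      fix \<tau> :: real
      have "rate \<tau> * norm (u n \<tau> - 1) \<le> rate \<tau> * (2 * norm (h \<tau>) + 1)" if "0 \<le> \<tau>"
        using u(3)[of n \<tau>] norm_triangle_ineq4[of "u n \<tau>" 1] rate_nonneg[OF that]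
        by (intro mult_left_mono) auto
      then show "norm (indicator {0..t} \<tau> *\<^sub>R (complex_of_real (rate \<tau>) * (u n \<tau> - 1))) \<le> ?w \<tau>"
        using rate_nonneg[of \<tau>] by (auto simp: indicator_def norm_mult distrib_left mult.left_commute)
    qed
  qed
  ultimately show "(LINT \<omega>|M. point_product h t \<omega>) =
      exp (LBINT \<tau>:{0..t}. of_real (rate \<tau>) * (h \<tau> - 1))"
    by (simp add: LIMSEQ_unique)
qed

text \<open>A set without intensity contains a Poisson number of points with mean \<open>0\<close>. Finiteness of the points up
to \<open>t\<close> is needed to conclude from a zero count that there are no points, as infinite sets have
cardinality \<open>0\<close> too.\<close>

lemma AE_points_avoid:
  assumes P: "{\<tau>. P \<tau>} \<in> sets borel" and t: "0 \<le> t"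
    and AE: "AE \<tau> in lborel. \<tau> \<in> {0..t} \<longrightarrow> rate \<tau> = 0 \<or> P \<tau>"
  shows "AE \<omega> in M. \<forall>i. T i \<omega> \<le> ereal t \<longrightarrow> P (real_of_ereal (T i \<omega>))"
proof -
  define B where "B = {0..t} - {\<tau>. P \<tau>}"
  have B: "B \<in> sets borel" "bounded B" "B \<subseteq> {0..}" "B \<subseteq> {0..t}"
    using P by (auto simp: B_def intro: bounded_subset[of "{0..t}"])
  have "(LBINT \<tau>:B. rate \<tau>) = (\<integral>\<tau>. 0 \<partial>(lborel :: real measure))"
    unfolding set_lebesgue_integral_def
  proof (rule Bochner_Integration.integral_cong_AE)
    show "(\<lambda>\<tau>. indicator B \<tau> *\<^sub>R rate \<tau>) \<in> borel_measurable lborel"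
      using rate_integrable_on[OF B(1,4)] unfolding set_integrable_def
      by (rule borel_measurable_integrable)
    show "AE \<tau> in lborel. indicator B \<tau> *\<^sub>R rate \<tau> = 0"
      using AE by eventually_elim (auto simp: B_def indicator_def)
  qed simp
  then have "prob {\<omega> \<in> space M. num_points T B \<omega> = 0} = 1"
    using num_points_poisson[OF B(1-3), of 0] by simp
  moreover have [measurable]: "num_points T B \<in> M \<rightarrow>\<^sub>M count_space UNIV"
    by (rule num_points_measurable[OF B(1-3)])
  ultimately have "AE \<omega> in M. num_points T B \<omega> = 0"
    by (subst (asm) prob_Collect_eq_1) auto
  then show ?thesis
    using points_locally_finite[of t] AE_space
  proof eventually_elim
    case (elim \<omega>)
    have "{i. T i \<omega> \<in> ereal ` B} \<subseteq> {i. T i \<omega> \<le> ereal t}"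
      using B(4) by auto
    then have "finite {i. T i \<omega> \<in> ereal ` B}"
      using elim(2) by (rule finite_subset)
    then have *: "T i \<omega> \<notin> ereal ` B" for i
      using elim(1) by (auto simp: num_points_def)
    show ?case
    proof (intro allI impI)
      fix i assume "T i \<omega> \<le> ereal t"
      then show "P (real_of_ereal (T i \<omega>))"
        using *[of i] points_nonneg[OF elim(3), of i] by (cases "T i \<omega>") (auto simp: B_def)
    qed
  qed
qed

end

section \<open>Independence and measurability of the sources of randomness\<close>

lemma space_generated_algebra [simp]: "space (generated_algebra \<Omega> I Y N) = \<Omega>"
  unfolding generated_algebra_def by (rule space_measure_of) auto

lemma measurable_generated_algebra:
  assumes "i \<in> I" "Y i \<in> \<Omega> \<rightarrow> space N"
  shows "Y i \<in> generated_algebra \<Omega> I Y N \<rightarrow>\<^sub>M N"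
proof (rule measurableI)
  fix A assume "A \<in> sets N"
  then have "Y i -` A \<inter> \<Omega> \<in> (\<Union>i\<in>I. {Y i -` A \<inter> \<Omega> | A. A \<in> sets N})"
    using assms(1) by blast
  then show "Y i -` A \<inter> space (generated_algebra \<Omega> I Y N) \<in> sets (generated_algebra \<Omega> I Y N)"
    unfolding space_generated_algebra unfolding generated_algebra_def
    by (subst sets_measure_of) (auto intro: sigma_sets.Basic)
qed (use assms in auto)

context batch_network
begin

text \<open>The identity map into each of these \<open>\<sigma>\<close>-algebras on \<open>space M\<close> carries all the information of one source.
Thus a point of a product of such spaces assigns an outcome to each source separately.\<close>

definition source_algebra :: "'n source \<Rightarrow> 'a measure" where
  "source_algebra s = (case s of
      Arrivals \<Rightarrow> generated_algebra (space M) UNIV T borel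
    | Batch i \<Rightarrow> generated_algebra (space M) {i} batch (count_space UNIV)
    | Route j i l \<Rightarrow> generated_algebra (space M) {0..} (X j i l) (count_space UNIV))"

lemma source_indep: "indep_vars source_algebra (\<lambda>s \<omega>. \<omega>) UNIV"
proof -
  have space: "space (source_algebra s) = space M" for s
    by (simp add: source_algebra_def split: source.split)
  have eq: "(case s of
      Arrivals \<Rightarrow> sets (generated_algebra (space M) UNIV T borel)
    | Batch i \<Rightarrow> sets (generated_algebra (space M) {i} batch (count_space UNIV))
    | Route j i l \<Rightarrow> sets (generated_algebra (space M) {0..} (X j i l) (count_space UNIV)))
    = sets (source_algebra s)" for s
    by (simp add: source_algebra_def split: source.split)
  have ind: "indep_sets (\<lambda>s. sets (source_algebra s)) UNIV"
    using sources_indep unfolding eq .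
  then have sub: "sets (source_algebra s) \<subseteq> events" for s
    by (auto simp: indep_sets_def)
  have "{(\<lambda>\<omega>. \<omega>) -` A \<inter> space M |A. A \<in> sets (source_algebra s)} = sets (source_algebra s)" for s
    using sets.sets_into_space[of _ "source_algebra s"] by (auto simp: space Int_absorb2)
  then show ?thesis
    unfolding indep_vars_def2 using ind sub space
    by (auto intro!: measurableI simp: sets.sets_into_space Int_absorb2 subset_eq)
qed

lemma source_split:
  assumes "U \<inter> V = {}"
  shows "indep_var (PiM U source_algebra) (\<lambda>\<omega>. \<lambda>s\<in>U. \<omega>) (PiM V source_algebra) (\<lambda>\<omega>. \<lambda>s\<in>V. \<omega>)"
  using assms by (intro indep_var_restrict[OF source_indep]) auto

lemma points_measurable_source: "T i \<in> borel_measurable (source_algebra Arrivals)"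
  unfolding source_algebra_def by (simp add: measurable_generated_algebra)

lemma batch_measurable_source: "batch i \<in> source_algebra (Batch i) \<rightarrow>\<^sub>M count_space UNIV"
  unfolding source_algebra_def by (simp add: measurable_generated_algebra)

text \<open>The age \<open>v\<close> may depend on one coordinate of \<open>N\<close> and the outcome \<open>x\<close> on another, as for a random arrival
time that is independent of the route. Negative ages, about which nothing is known, are cut off.\<close>

lemma position_measurable:
  assumes [measurable]: "v \<in> borel_measurable N" "x \<in> N \<rightarrow>\<^sub>M source_algebra (Route j i l)"
  shows "(\<lambda>w. X j i l (max 0 (v w)) (x w)) \<in> N \<rightarrow>\<^sub>M count_space UNIV"
proof -
  have "(\<lambda>w. (max 0 (v w), x w)) \<in> N \<rightarrow>\<^sub>M restrict_space borel {0..} \<Otimes>\<^sub>M source_algebra (Route j i l)"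
    by (intro measurable_Pair measurable_restrict_space2) auto
  from measurable_compose[OF this, of "\<lambda>(u, \<omega>). X j i l u \<omega>" "count_space UNIV"]
  show ?thesis
    using route_measurable[of j i l] by (simp add: source_algebra_def)
qed

lemma identity_measurable_source: "(\<lambda>\<omega>. \<omega>) \<in> M \<rightarrow>\<^sub>M source_algebra s"
  using source_indep unfolding indep_vars_def2 by blast

lemma route_measurable_fixed:
  assumes "0 \<le> u"
  shows "X j i l u \<in> source_algebra (Route j i l) \<rightarrow>\<^sub>M count_space UNIV"
  using position_measurable[of "\<lambda>_. u" "source_algebra (Route j i l)" "\<lambda>w. w" j i l] assms
  by (simp add: max_def)

end

section \<open>Averaging over the routes and the batches\<close>

context batch_network
begin

text \<open>The product \<open>\<Prod>\<^sub>k z\<^sub>k ^ N\<^sub>k(t)\<close> with arrival times \<open>\<tau>\<close>, batches \<open>b\<close> and an outcome \<open>x j i l\<close> for each route as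
separate arguments, so that these can be integrated one after the other.\<close>

definition customer_product ::
  "('n \<Rightarrow> 'b::comm_monoid_mult) \<Rightarrow> real \<Rightarrow> (nat \<Rightarrow> ereal) \<Rightarrow> (nat \<Rightarrow> nat ^ 'n) \<Rightarrow>
   ('n \<Rightarrow> nat \<Rightarrow> nat \<Rightarrow> 'a) \<Rightarrow> 'b" where
  "customer_product z t \<tau> b x = (\<Prod>k\<in>UNIV. z k ^ card {(j, i, l).
    \<tau> i \<le> ereal t \<and> l < b i $ j \<and> X j i l (t - real_of_ereal (\<tau> i)) (x j i l) = Some k})"

lemma customer_product_measurable:
  fixes z :: "'n \<Rightarrow> 'b::{real_normed_field, second_countable_topology}"
  assumes t: "0 \<le> t"
    and \<tau>[measurable]: "\<And>i. (\<lambda>w. \<tau> w i) \<in> borel_measurable N"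
    and b[measurable]: "\<And>i. (\<lambda>w. b w i) \<in> N \<rightarrow>\<^sub>M count_space UNIV"
    and x: "\<And>j i l. (\<lambda>w. x w j i l) \<in> N \<rightarrow>\<^sub>M source_algebra (Route j i l)"
  shows "(\<lambda>w. customer_product z t (\<tau> w) (b w) (x w)) \<in> borel_measurable N"
proof -
  have [measurable]: "(\<lambda>w. card {(j, i, l). \<tau> w i \<le> ereal t \<and> l < b w i $ j \<and>
      X j i l (t - real_of_ereal (\<tau> w i)) (x w j i l) = Some k}) \<in> N \<rightarrow>\<^sub>M count_space UNIV" for k
  proof (rule measurable_card_countable)
    fix c :: "'n \<times> nat \<times> nat"
    obtain j i l where c: "c = (j, i, l)" by (cases c)
    have [measurable]: "(\<lambda>w. X j i l (max 0 (t - real_of_ereal (\<tau> w i))) (x w j i l)) \<in> N \<rightarrow>\<^sub>M count_space UNIV"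
      by (rule position_measurable) (auto intro: x)
    have "max 0 (t - real_of_ereal (\<tau> w i)) = t - real_of_ereal (\<tau> w i)" if "\<tau> w i \<le> ereal t" for w
      using that t by (cases "\<tau> w i") auto
    then have "{w \<in> space N. c \<in> {(j, i, l). \<tau> w i \<le> ereal t \<and> l < b w i $ j \<and>
          X j i l (t - real_of_ereal (\<tau> w i)) (x w j i l) = Some k}} =
        {w \<in> space N. \<tau> w i \<le> ereal t \<and> l < b w i $ j \<and>
          X j i l (max 0 (t - real_of_ereal (\<tau> w i))) (x w j i l) = Some k}"
      by (auto simp: c)
    also have "\<dots> \<in> sets N" by measurable
    finally show "{w \<in> space N. c \<in> {(j, i, l). \<tau> w i \<le> ereal t \<and> l < b w i $ j \<and>
          X j i l (t - real_of_ereal (\<tau> w i)) (x w j i l) = Some k}} \<in> sets N" .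
  qed
  have "(\<lambda>w. z k ^ card {(j, i, l). \<tau> w i \<le> ereal t \<and> l < b w i $ j \<and>
      X j i l (t - real_of_ereal (\<tau> w i)) (x w j i l) = Some k}) \<in> borel_measurable N" for k
    by (rule measurable_compose[of _ N "count_space UNIV"]) measurable
  then show ?thesis
    unfolding customer_product_def by (intro borel_measurable_prod)
qed

text \<open>The average of \<open>customer_product\<close> over the routes, when \<open>m j u\<close> is the mean factor of a customer who
entered queue \<open>j\<close> a time \<open>u\<close> ago. The truncation of the age at \<open>0\<close> does not change it at points up to a
time \<open>t \<ge> 0\<close>; it keeps the factor a measurable function of an arbitrary arrival time.\<close>

definition batch_product ::
  "('n \<Rightarrow> real \<Rightarrow> 'b::comm_monoid_mult) \<Rightarrow> real \<Rightarrow> (nat \<Rightarrow> ereal) \<Rightarrow> (nat \<Rightarrow> nat ^ 'n) \<Rightarrow> 'b" where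
  "batch_product m t \<tau> b = (\<Prod>i\<in>{i. \<tau> i \<le> ereal t}. \<Prod>j\<in>UNIV.
    m j (max 0 (t - real_of_ereal (\<tau> i))) ^ (b i $ j))"

lemma batch_product_measurable:
  fixes m :: "'n \<Rightarrow> real \<Rightarrow> 'b::{real_normed_field, banach, second_countable_topology}"
  assumes m: "\<And>j. (\<lambda>u. m j (max 0 u)) \<in> borel_measurable borel"
    and \<tau>[measurable]: "\<And>i. (\<lambda>w. \<tau> w i) \<in> borel_measurable N"
    and b[measurable]: "\<And>i. (\<lambda>w. b w i) \<in> N \<rightarrow>\<^sub>M count_space UNIV"
  shows "(\<lambda>w. batch_product m t (\<tau> w) (b w)) \<in> borel_measurable N"
proof -
  have [measurable]: "(\<lambda>w. m j (max 0 (t - real_of_ereal (\<tau> w i)))) \<in> borel_measurable N" for i j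
    by (rule measurable_compose[OF _ m]) measurable
  have "(\<lambda>w. m j (max 0 (t - real_of_ereal (\<tau> w i))) ^ (b w i $ j)) \<in> borel_measurable N" for i j
    by (rule measurable_compose_countable[where g="\<lambda>w. b w i"]) measurable
  then show ?thesis
    unfolding batch_product_def
    by (intro borel_measurable_prod_random_index borel_measurable_prod) measurable
qed

definition position_mean :: "('n \<Rightarrow> 'b::real_normed_field) \<Rightarrow> 'n \<Rightarrow> real \<Rightarrow> 'b" where
  "position_mean z j u = 1 + (\<Sum>k\<in>UNIV. (z k - 1) * of_real (q j k u))"

definition position_weight :: "('n \<Rightarrow> 'b) \<Rightarrow> 'n option \<Rightarrow> 'b::one" where
  "position_weight z p = (case p of None \<Rightarrow> 1 | Some k \<Rightarrow> z k)"

text \<open>The weight is \<open>1 + \<Sum>\<^sub>k (z\<^sub>k - 1) 1{X = k}\<close>, which is linear in indicators.\<close>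

lemma position_weight_integral:
  fixes z :: "'n \<Rightarrow> 'b::{real_normed_field, banach, second_countable_topology}"
  assumes u: "0 \<le> u"
  shows "has_bochner_integral M (\<lambda>\<omega>. position_weight z (X j i l u \<omega>)) (position_mean z j u)"
proof -
  have X[measurable]: "X j i l u \<in> M \<rightarrow>\<^sub>M count_space UNIV"
    by (rule measurable_compose[OF identity_measurable_source route_measurable_fixed[OF u]])
  let ?E = "\<lambda>k. {\<omega> \<in> space M. X j i l u \<omega> = Some k}"
  have "has_bochner_integral M (\<lambda>\<omega>. 1 + (\<Sum>k\<in>UNIV. indicator (?E k) \<omega> *\<^sub>R (z k - 1)))
      (prob (space M) *\<^sub>R 1 + (\<Sum>k\<in>UNIV. prob (?E k) *\<^sub>R (z k - 1)))"
    by (intro has_bochner_integral_add has_bochner_integral_sum has_bochner_integral_indicator)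
      (auto simp: has_bochner_integral_iff prob_space emeasure_eq_measure)
  also have "prob (space M) *\<^sub>R 1 + (\<Sum>k\<in>UNIV. prob (?E k) *\<^sub>R (z k - 1)) = position_mean z j u"
    by (simp add: position_mean_def prob_space route_prob[OF u] scaleR_conv_of_real mult.commute)
  finally have "has_bochner_integral M (\<lambda>\<omega>. 1 + (\<Sum>k\<in>UNIV. indicator (?E k) \<omega> *\<^sub>R (z k - 1)))
      (position_mean z j u)" .
  moreover have "1 + (\<Sum>k\<in>UNIV. indicator (?E k) \<omega> *\<^sub>R (z k - 1)) = position_weight z (X j i l u \<omega>)"
    if \<omega>: "\<omega> \<in> space M" for \<omega>
  proof -
    have "(\<Sum>k\<in>UNIV. indicator (?E k) \<omega> *\<^sub>R (z k - 1)) =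
        (\<Sum>k\<in>UNIV. if X j i l u \<omega> = Some k then z k - 1 else 0)"
      using \<omega> by (intro sum.cong) (auto simp: indicator_def)
    then show ?thesis
      by (cases "X j i l u \<omega>") (auto simp: position_weight_def)
  qed
  ultimately show ?thesis
    by (subst has_bochner_integral_cong[OF refl _ refl]) auto
qed

text \<open>The mean inherits measurability in the age from the routes, as it is the integral of a jointly
measurable function of age and outcome; the route with \<open>i = l = 0\<close> represents all routes from
queue \<open>j\<close>, which have the same one-dimensional laws.\<close>

lemma position_mean_measurable:
  fixes z :: "'n \<Rightarrow> 'b::{real_normed_field, banach, second_countable_topology}"
  shows "(\<lambda>u. position_mean z j (max 0 u)) \<in> borel_measurable borel"
proof -
  let ?D = "distr M (source_algebra (Route j 0 0)) (\<lambda>\<omega>. \<omega>)"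
  have id: "(\<lambda>\<omega>. \<omega>) \<in> M \<rightarrow>\<^sub>M source_algebra (Route j 0 0)"
    by (rule identity_measurable_source)
  interpret D: prob_space ?D
    by (rule prob_space_distr[OF id])
  have "(\<lambda>w. X j 0 0 (max 0 (fst w)) (snd w)) \<in> borel \<Otimes>\<^sub>M ?D \<rightarrow>\<^sub>M count_space UNIV"
    by (rule position_measurable) auto
  then have "(\<lambda>w. position_weight z (X j 0 0 (max 0 (fst w)) (snd w))) \<in> borel_measurable (borel \<Otimes>\<^sub>M ?D)"
    by (rule measurable_compose) simp
  then have "(\<lambda>u. LINT \<omega>|?D. position_weight z (X j 0 0 (max 0 u) \<omega>)) \<in> borel_measurable borel"
    by (intro D.borel_measurable_lebesgue_integral) (simp add: case_prod_beta')
  moreover have "(LINT \<omega>|?D. position_weight z (X j 0 0 (max 0 u) \<omega>)) = position_mean z j (max 0 u)" for u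
  proof -
    have [measurable]: "X j 0 0 (max 0 u) \<in> source_algebra (Route j 0 0) \<rightarrow>\<^sub>M count_space UNIV"
      by (rule route_measurable_fixed) simp
    have "(\<lambda>\<omega>. position_weight z (X j 0 0 (max 0 u) \<omega>)) \<in> borel_measurable (source_algebra (Route j 0 0))"
      by (rule measurable_compose[where N="count_space UNIV"]) auto
    then have "(LINT \<omega>|?D. position_weight z (X j 0 0 (max 0 u) \<omega>)) =
        (LINT \<omega>|M. position_weight z (X j 0 0 (max 0 u) \<omega>))"
      by (rule integral_distr[OF id])
    also have "\<dots> = position_mean z j (max 0 u)"
      using position_weight_integral[of "max 0 u" z j 0 0] by (simp add: has_bochner_integral_iff)
    finally show ?thesis .
  qed
  ultimately show ?thesis by simp
qed

lemma norm_position_weight: "norm (position_weight z p) = position_weight (\<lambda>k. norm (z k)) p"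
  for z :: "'n \<Rightarrow> 'b::real_normed_field"
  by (simp add: position_weight_def split: option.split)

lemma norm_customer_product:
  "norm (customer_product z t \<tau> b x) = customer_product (\<lambda>k. norm (z k)) t \<tau> b x"
  for z :: "'n \<Rightarrow> 'b::real_normed_field"
  by (simp add: customer_product_def prod_norm[symmetric] norm_power)

lemma norm_position_mean_le:
  fixes z :: "'n \<Rightarrow> 'b::{real_normed_field, banach, second_countable_topology}"
  assumes "0 \<le> u"
  shows "norm (position_mean z j u) \<le> position_mean (\<lambda>k. norm (z k)) j u"
  using integral_norm_bound[of M "\<lambda>\<omega>. position_weight z (X j 0 0 u \<omega>)"]
    position_weight_integral[OF assms, of z j 0 0]
    position_weight_integral[OF assms, of "\<lambda>k. norm (z k)" j 0 0]
  by (simp add: has_bochner_integral_iff norm_position_weight)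

lemma position_mean_nonneg:
  fixes w :: "'n \<Rightarrow> real"
  assumes "\<And>k. 0 \<le> w k" "0 \<le> u"
  shows "0 \<le> position_mean w j u"
  using order_trans[OF norm_ge_zero norm_position_mean_le[OF assms(2), of w j]] assms(1) by simp

text \<open>For fixed arrival times and batches the product has finitely many factors, one for each customer, and
they depend on different routes. Each factor takes finitely many values and is therefore integrable.\<close>

lemma customer_product_route_integral:
  fixes z :: "'n \<Rightarrow> 'b::{real_normed_field, banach, second_countable_topology}"
  assumes t: "0 \<le> t" and fin: "finite {i. \<tau> i \<le> ereal t}"
  shows "has_bochner_integral M (\<lambda>\<omega>. customer_product z t \<tau> b (\<lambda>j i l. \<omega>))
    (batch_product (position_mean z) t \<tau> b)"
proof -
  let ?I = "{i. \<tau> i \<le> ereal t}"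
  define age where "age i = max 0 (t - real_of_ereal (\<tau> i))" for i
  have age: "t - real_of_ereal (\<tau> i) = age i" if "i \<in> ?I" for i
    using that t by (cases "\<tau> i") (auto simp: age_def)
  have age_nn: "0 \<le> age i" for i by (simp add: age_def)
  define P where "P = (SIGMA i:?I. SIGMA j:UNIV. {..<b i $ j})"
  have "finite P"
    using fin unfolding P_def by (intro finite_SigmaI) auto
  define W where "W p \<omega> = (case p of (i, j, l) \<Rightarrow> position_weight z (X j i l (age i) \<omega>))" for p \<omega>
  have eq: "customer_product z t \<tau> b (\<lambda>j i l. \<omega>) = (\<Prod>p\<in>P. W p \<omega>)" for \<omega>
  proof -
    have bij: "bij_betw (\<lambda>(j, i, l). (i, j, l))
        {(j, i, l). \<tau> i \<le> ereal t \<and> l < b i $ j \<and> X j i l (t - real_of_ereal (\<tau> i)) \<omega> = Some k}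
        {p \<in> P. (case p of (i, j, l) \<Rightarrow> X j i l (age i) \<omega>) = Some k}" for k
      using age by (intro bij_betw_byWitness[where f'="\<lambda>(i, j, l). (j, i, l)"]) (auto simp: P_def)
    have "customer_product z t \<tau> b (\<lambda>j i l. \<omega>) =
        (\<Prod>k\<in>UNIV. z k ^ card {p \<in> P. (case p of (i, j, l) \<Rightarrow> X j i l (age i) \<omega>) = Some k})"
      unfolding customer_product_def
      by (intro prod.cong refl arg_cong2[where f=power] bij_betw_same_card[OF bij])
    also have "\<dots> = (\<Prod>p\<in>P. W p \<omega>)"
      unfolding prod_case_option_eq_prod_power[OF \<open>finite P\<close>, symmetric]
      by (intro prod.cong refl) (auto simp: W_def position_weight_def)
    finally show ?thesis .
  qed
  have "indep_vars (\<lambda>p. source_algebra (case p of (i, j, l) \<Rightarrow> Route j i l)) (\<lambda>p \<omega>. \<omega>) P"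
    by (rule indep_vars_reindex[OF source_indep]) (auto simp: inj_on_def)
  then have ind: "indep_vars (\<lambda>_. borel) W P"
  proof (rule indep_vars_compose2)
    fix p assume "p \<in> P"
    obtain i j l where p: "p = (i, j, l)" by (cases p)
    have "(\<lambda>\<omega>. position_weight z (X j i l (age i) \<omega>)) \<in> borel_measurable (source_algebra (Route j i l))"
      by (rule measurable_compose[OF route_measurable_fixed[OF age_nn]]) simp
    then show "W p \<in> borel_measurable (source_algebra (case p of (i, j, l) \<Rightarrow> Route j i l))"
      by (simp add: p W_def[abs_def])
  qed
  have W: "has_bochner_integral M (W (i, j, l)) (position_mean z j (age i))" for i j l
    using position_weight_integral[OF age_nn, of z j i l i] by (simp add: W_def[abs_def])
  have int: "integrable M (W p)" for p
    using W by (cases p) (auto simp: has_bochner_integral_iff)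
  have "(LINT \<omega>|M. (\<Prod>p\<in>P. W p \<omega>)) = (\<Prod>p\<in>P. LINT \<omega>|M. W p \<omega>)"
    by (rule indep_vars_lebesgue_integral[OF \<open>finite P\<close> ind int])
  also have "\<dots> = (\<Prod>(i, j, l)\<in>P. position_mean z j (age i))"
    using W by (intro prod.cong refl) (auto simp: has_bochner_integral_iff)
  also have "\<dots> = (\<Prod>i\<in>?I. \<Prod>(j, l)\<in>(SIGMA j:UNIV. {..<b i $ j}). position_mean z j (age i))"
    unfolding P_def using fin by (subst prod.Sigma) auto
  also have "\<dots> = (\<Prod>i\<in>?I. \<Prod>j\<in>UNIV. \<Prod>l<b i $ j. position_mean z j (age i))"
    by (intro prod.cong refl) (subst prod.Sigma, auto)
  also have "\<dots> = batch_product (position_mean z) t \<tau> b"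
    by (simp add: batch_product_def age_def)
  finally show ?thesis
    using indep_vars_integrable[OF \<open>finite P\<close> ind int] unfolding eq
    by (simp add: has_bochner_integral_iff)
qed

lemma batch_indep: "indep_vars (\<lambda>_. count_space UNIV) batch UNIV"
proof -
  have "indep_vars (\<lambda>i. source_algebra (Batch i)) (\<lambda>i \<omega>. \<omega>) (UNIV :: nat set)"
    by (rule indep_vars_reindex[OF source_indep]) (auto simp: inj_on_def)
  then show ?thesis
    by (rule indep_vars_compose2) (rule batch_measurable_source)
qed

text \<open>In \<open>[0, \<infinity>]\<close> independent factors always multiply. A factor with mean \<open>0\<close> may thus hide another one with
infinite mean, which is why the finiteness of the means has to be established through the intensity
rather than from the finiteness of this product.\<close>

lemma batch_product_nn_integral:
  fixes m :: "'n \<Rightarrow> real \<Rightarrow> real"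
  assumes fin: "finite {i. \<tau> i \<le> ereal t}" and m: "\<And>j u. 0 \<le> u \<Longrightarrow> 0 \<le> m j u"
  shows "(\<integral>\<^sup>+\<omega>. ennreal (batch_product m t \<tau> (\<lambda>i. batch i \<omega>)) \<partial>M) =
    (\<Prod>i\<in>{i. \<tau> i \<le> ereal t}. \<integral>\<^sup>+s. ennreal (\<Prod>j\<in>UNIV. m j (max 0 (t - real_of_ereal (\<tau> i))) ^ (s $ j)) \<partial>S)"
proof -
  let ?I = "{i. \<tau> i \<le> ereal t}"
  let ?g = "\<lambda>i s. ennreal (\<Prod>j\<in>UNIV. m j (max 0 (t - real_of_ereal (\<tau> i))) ^ (s $ j))"
  have "indep_vars (\<lambda>_. borel) (\<lambda>i \<omega>. ?g i (batch i \<omega>)) ?I"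
    by (rule indep_vars_compose2[OF indep_vars_subset[OF batch_indep]]) auto
  from indep_vars_nn_integral[OF fin this]
  have "(\<integral>\<^sup>+\<omega>. (\<Prod>i\<in>?I. ?g i (batch i \<omega>)) \<partial>M) = (\<Prod>i\<in>?I. \<integral>\<^sup>+\<omega>. ?g i (batch i \<omega>) \<partial>M)"
    by simp
  moreover have "(\<Prod>i\<in>?I. ?g i (batch i \<omega>)) = ennreal (batch_product m t \<tau> (\<lambda>i. batch i \<omega>))" for \<omega>
    unfolding batch_product_def by (intro prod_ennreal prod_nonneg zero_le_power m) auto
  moreover have "(\<integral>\<^sup>+\<omega>. ?g i (batch i \<omega>) \<partial>M) = (\<integral>\<^sup>+s. ?g i s \<partial>S)" for i
    unfolding batch_distr[of i, symmetric] by (subst nn_integral_distr[OF batch_measurable]) auto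
  ultimately show ?thesis by simp
qed

lemma batch_product_integral:
  fixes m :: "'n \<Rightarrow> real \<Rightarrow> 'b::{real_normed_field, banach, second_countable_topology}"
  assumes fin: "finite {i. \<tau> i \<le> ereal t}"
    and int: "\<And>i. \<tau> i \<le> ereal t \<Longrightarrow>
      integrable S (\<lambda>s. \<Prod>j\<in>UNIV. m j (max 0 (t - real_of_ereal (\<tau> i))) ^ (s $ j))"
  shows "(LINT \<omega>|M. batch_product m t \<tau> (\<lambda>i. batch i \<omega>)) =
    (\<Prod>i\<in>{i. \<tau> i \<le> ereal t}. LINT s|S. (\<Prod>j\<in>UNIV. m j (max 0 (t - real_of_ereal (\<tau> i))) ^ (s $ j)))"
proof -
  let ?I = "{i. \<tau> i \<le> ereal t}"
  let ?g = "\<lambda>i s. (\<Prod>j\<in>UNIV. m j (max 0 (t - real_of_ereal (\<tau> i))) ^ (s $ j))"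
  have ind: "indep_vars (\<lambda>_. borel) (\<lambda>i \<omega>. ?g i (batch i \<omega>)) ?I"
    by (rule indep_vars_compose2[OF indep_vars_subset[OF batch_indep]]) auto
  have "integrable M (\<lambda>\<omega>. ?g i (batch i \<omega>))" if "i \<in> ?I" for i
    using int[of i] that integrable_distr[OF batch_measurable[of i], of "?g i"]
    by (simp add: batch_distr)
  from indep_vars_lebesgue_integral[OF fin ind this]
  have "(LINT \<omega>|M. (\<Prod>i\<in>?I. ?g i (batch i \<omega>))) = (\<Prod>i\<in>?I. LINT \<omega>|M. ?g i (batch i \<omega>))"
    by simp
  moreover have "(LINT \<omega>|M. ?g i (batch i \<omega>)) = (LINT s|S. ?g i s)" for i
    unfolding batch_distr[of i, symmetric] by (subst integral_distr[OF batch_measurable]) auto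
  ultimately show ?thesis
    by (simp add: batch_product_def)
qed

definition entry_sources :: "'n source set" where
  "entry_sources = insert Arrivals (range Batch)"

lemma mem_entry_sources [simp]:
  "Arrivals \<in> entry_sources" "Batch i \<in> entry_sources" "Route j i l \<notin> entry_sources"
  by (auto simp: entry_sources_def)

lemma routes_indep:
  "indep_var (PiM entry_sources source_algebra) (\<lambda>\<omega>. \<lambda>s\<in>entry_sources. \<omega>)
    (PiM (- entry_sources) source_algebra) (\<lambda>\<omega>. \<lambda>s\<in>- entry_sources. \<omega>)"
  by (rule source_split) auto

lemma batches_indep:
  "indep_var (PiM {Arrivals} source_algebra) (\<lambda>\<omega>. \<lambda>s\<in>{Arrivals}. \<omega>)
    (PiM (range Batch) source_algebra) (\<lambda>\<omega>. \<lambda>s\<in>range Batch. \<omega>)"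
  by (rule source_split) auto

lemma component_measurable:
  assumes "s \<in> U" "f \<in> N \<rightarrow>\<^sub>M PiM U source_algebra" "g \<in> source_algebra s \<rightarrow>\<^sub>M K"
  shows "(\<lambda>w. g (f w s)) \<in> N \<rightarrow>\<^sub>M K"
  by (intro measurable_compose[OF measurable_compose[OF assms(2) measurable_component_singleton] assms(3)] assms(1))

lemma split_customer_product_measurable:
  fixes z :: "'n \<Rightarrow> 'b::{real_normed_field, second_countable_topology}"
  assumes t: "0 \<le> t"
  shows "(\<lambda>w. customer_product z t (\<lambda>i. T i (fst w Arrivals)) (\<lambda>i. batch i (fst w (Batch i)))
      (\<lambda>j i l. snd w (Route j i l)))
    \<in> borel_measurable (PiM entry_sources source_algebra \<Otimes>\<^sub>M PiM (- entry_sources) source_algebra)"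
proof (rule customer_product_measurable[OF t])
  show "(\<lambda>w. T i (fst w Arrivals))
      \<in> borel_measurable (PiM entry_sources source_algebra \<Otimes>\<^sub>M PiM (- entry_sources) source_algebra)" for i
    by (rule component_measurable[OF _ measurable_fst points_measurable_source]) simp
  show "(\<lambda>w. batch i (fst w (Batch i)))
      \<in> PiM entry_sources source_algebra \<Otimes>\<^sub>M PiM (- entry_sources) source_algebra \<rightarrow>\<^sub>M count_space UNIV" for i
    by (rule component_measurable[OF _ measurable_fst batch_measurable_source]) simp
  show "(\<lambda>w. snd w (Route j i l))
      \<in> PiM entry_sources source_algebra \<Otimes>\<^sub>M PiM (- entry_sources) source_algebra
        \<rightarrow>\<^sub>M source_algebra (Route j i l)" for j i l
    by (rule component_measurable[OF _ measurable_snd, where g="\<lambda>\<omega>. \<omega>"]) auto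
qed

lemma split_batch_product_measurable:
  fixes z :: "'n \<Rightarrow> 'b::{real_normed_field, banach, second_countable_topology}"
  shows "(\<lambda>w. batch_product (position_mean z) t (\<lambda>i. T i (fst w Arrivals)) (\<lambda>i. batch i (snd w (Batch i))))
    \<in> borel_measurable (PiM {Arrivals} source_algebra \<Otimes>\<^sub>M PiM (range Batch) source_algebra)"
proof (rule batch_product_measurable[OF position_mean_measurable])
  show "(\<lambda>w. T i (fst w Arrivals))
      \<in> borel_measurable (PiM {Arrivals} source_algebra \<Otimes>\<^sub>M PiM (range Batch) source_algebra)" for i
    by (rule component_measurable[OF _ measurable_fst points_measurable_source]) simp
  show "(\<lambda>w. batch i (snd w (Batch i)))
      \<in> PiM {Arrivals} source_algebra \<Otimes>\<^sub>M PiM (range Batch) source_algebra \<rightarrow>\<^sub>M count_space UNIV" for i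
    by (rule component_measurable[OF _ measurable_snd batch_measurable_source]) simp
qed

text \<open>The two averaging steps in \<open>[0, \<infinity>]\<close>, by Tonelli's theorem. The right-hand side may be infinite; that it
is finite when the left-hand side is, transfers integrability of the occupancy product to the arrival
process.\<close>

lemma customer_product_nn_integral:
  fixes w :: "'n \<Rightarrow> real"
  assumes t: "0 \<le> t" and w: "\<And>k. 0 \<le> w k"
  shows "(\<integral>\<^sup>+\<omega>. ennreal (customer_product w t (\<lambda>i. T i \<omega>) (\<lambda>i. batch i \<omega>) (\<lambda>j i l. \<omega>)) \<partial>M) =
    (\<integral>\<^sup>+\<omega>. point_product (\<lambda>\<tau>. \<integral>\<^sup>+s. ennreal (\<Prod>j\<in>UNIV. position_mean w j (max 0 (t - \<tau>)) ^ (s $ j)) \<partial>S) t \<omega> \<partial>M)"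
proof -
  have "(\<integral>\<^sup>+\<omega>. ennreal (customer_product w t (\<lambda>i. T i \<omega>) (\<lambda>i. batch i \<omega>) (\<lambda>j i l. \<omega>)) \<partial>M) =
      (\<integral>\<^sup>+\<omega>. \<integral>\<^sup>+\<omega>'. ennreal (customer_product w t (\<lambda>i. T i \<omega>) (\<lambda>i. batch i \<omega>) (\<lambda>j i l. \<omega>')) \<partial>M \<partial>M)"
    using indep_var_nn_integral[OF routes_indep
        measurable_compose[OF split_customer_product_measurable[OF t] measurable_ennreal], of w]
    by simp
  also have "\<dots> = (\<integral>\<^sup>+\<omega>. ennreal (batch_product (position_mean w) t (\<lambda>i. T i \<omega>) (\<lambda>i. batch i \<omega>)) \<partial>M)"
  proof (rule nn_integral_cong_AE)
    show "AE \<omega> in M. (\<integral>\<^sup>+\<omega>'. ennreal (customer_product w t (\<lambda>i. T i \<omega>) (\<lambda>i. batch i \<omega>) (\<lambda>j i l. \<omega>')) \<partial>M) =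
        ennreal (batch_product (position_mean w) t (\<lambda>i. T i \<omega>) (\<lambda>i. batch i \<omega>))"
      using points_locally_finite[of t]
    proof eventually_elim
      case (elim \<omega>)
      have "has_bochner_integral M
          (\<lambda>\<omega>'. customer_product w t (\<lambda>i. T i \<omega>) (\<lambda>i. batch i \<omega>) (\<lambda>j i l. \<omega>'))
          (batch_product (position_mean w) t (\<lambda>i. T i \<omega>) (\<lambda>i. batch i \<omega>))"
        by (rule customer_product_route_integral[OF t elim])
      then show ?case
        using w by (subst nn_integral_eq_integral)
          (auto simp: has_bochner_integral_iff customer_product_def intro!: prod_nonneg)
    qed
  qed
  also have "\<dots> = (\<integral>\<^sup>+\<omega>. \<integral>\<^sup>+\<omega>'. ennreal (batch_product (position_mean w) t (\<lambda>i. T i \<omega>) (\<lambda>i. batch i \<omega>')) \<partial>M \<partial>M)"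
    using indep_var_nn_integral[OF batches_indep
        measurable_compose[OF split_batch_product_measurable measurable_ennreal], of w t]
    by simp
  also have "\<dots> = (\<integral>\<^sup>+\<omega>. point_product (\<lambda>\<tau>. \<integral>\<^sup>+s. ennreal (\<Prod>j\<in>UNIV. position_mean w j (max 0 (t - \<tau>)) ^ (s $ j)) \<partial>S) t \<omega> \<partial>M)"
  proof (rule nn_integral_cong_AE)
    show "AE \<omega> in M. (\<integral>\<^sup>+\<omega>'. ennreal (batch_product (position_mean w) t (\<lambda>i. T i \<omega>) (\<lambda>i. batch i \<omega>')) \<partial>M) =
        point_product (\<lambda>\<tau>. \<integral>\<^sup>+s. ennreal (\<Prod>j\<in>UNIV. position_mean w j (max 0 (t - \<tau>)) ^ (s $ j)) \<partial>S) t \<omega>"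
      using points_locally_finite[of t]
      by eventually_elim (simp add: batch_product_nn_integral position_mean_nonneg w point_product_def)
  qed
  finally show ?thesis .
qed

end

section \<open>The generating function of the occupancy vector\<close>

lemma pgf_measurable:
  fixes S :: "(nat ^ 'n) pmf" and m :: "'n \<Rightarrow> real \<Rightarrow> complex"
  assumes [measurable]: "\<And>j. m j \<in> borel_measurable borel"
  shows "(\<lambda>\<tau>. pgf S (\<chi> j. m j \<tau>)) \<in> borel_measurable borel"
proof -
  have "(\<lambda>w. \<Prod>j\<in>UNIV. m j (fst w) ^ (snd w $ j)) \<in> borel_measurable (borel \<Otimes>\<^sub>M measure_pmf S)"
    by (rule measurable_compose_countable[where g=snd]) measurable
  then show ?thesis
    unfolding pgf_def
    by (intro measure_pmf.borel_measurable_lebesgue_integral) (simp add: case_prod_beta')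
qed

text \<open>Outside the domain the generating function is \<open>0\<close> by convention, so the bound holds for every \<open>z\<close>.\<close>

lemma norm_pgf_le:
  fixes S :: "(nat ^ 'n) pmf"
  shows "ennreal (norm (pgf S z)) \<le> (\<integral>\<^sup>+s. ennreal (\<Prod>j\<in>UNIV. norm (z $ j) ^ (s $ j)) \<partial>S)"
proof (cases "z \<in> pgf_domain S")
  case True
  then show ?thesis
    using integral_norm_bound_ennreal[of S "\<lambda>s. \<Prod>j\<in>UNIV. (z $ j) ^ (s $ j)"]
    by (simp add: pgf_def pgf_domain_def prod_norm[symmetric] norm_power)
next
  case False
  then show ?thesis
    by (simp add: pgf_def pgf_domain_def not_integrable_integral_eq)
qed

lemma pgf_domainI:
  fixes S :: "(nat ^ 'n) pmf"
  assumes "(\<integral>\<^sup>+s. ennreal (\<Prod>j\<in>UNIV. norm (z $ j) ^ (s $ j)) \<partial>S) < \<infinity>"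
  shows "z \<in> pgf_domain S"
  using assms unfolding pgf_domain_def mem_Collect_eq
  by (intro integrableI_bounded) (auto simp: prod_norm[symmetric] norm_power)

context batch_network
begin

lemma mixed_arg_eq_position_mean: "mixed_arg q z u $ j = position_mean (($) z) j u"
  by (simp add: mixed_arg_def position_mean_def)

lemma occupancy_eq_customer_product:
  "(\<Prod>k\<in>UNIV. z $ k ^ (occupancy T batch X t \<omega> $ k)) =
    customer_product (($) z) t (\<lambda>i. T i \<omega>) (\<lambda>i. batch i \<omega>) (\<lambda>j i l. \<omega>)"
  by (simp add: occupancy_def customer_product_def)

lemma occupancy_measurable:
  fixes z :: "complex ^ 'n"
  assumes "0 \<le> t"
  shows "(\<lambda>\<omega>. \<Prod>k\<in>UNIV. z $ k ^ (occupancy T batch X t \<omega> $ k)) \<in> borel_measurable M"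
  unfolding occupancy_eq_customer_product
  by (intro customer_product_measurable assms points_measurable batch_measurable identity_measurable_source)

lemma integrable_unit_polydisc:
  assumes "0 \<le> t" "z \<in> unit_polydisc"
  shows "integrable M (\<lambda>\<omega>. \<Prod>k\<in>UNIV. z $ k ^ (occupancy T batch X t \<omega> $ k))"
proof (rule integrable_const_bound[where B=1])
  show "AE \<omega> in M. norm (\<Prod>k\<in>UNIV. z $ k ^ (occupancy T batch X t \<omega> $ k)) \<le> 1"
    using assms(2)
    by (auto simp: unit_polydisc_def prod_norm[symmetric] norm_power intro!: prod_le_1 power_le_one)
qed (rule occupancy_measurable[OF assms(1)])

text \<open>The generating function of a batch at the mixed arguments of the moduli \<open>\<bar>z\<^sub>k\<bar>\<close>, with value \<open>\<infinity>\<close> where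
it diverges.\<close>

definition absolute_pgf :: "complex ^ 'n \<Rightarrow> real \<Rightarrow> ennreal" where
  "absolute_pgf z u = (\<integral>\<^sup>+s. ennreal (\<Prod>j\<in>UNIV. position_mean (\<lambda>k. norm (z $ k)) j u ^ (s $ j)) \<partial>S)"

lemma absolute_pgf_measurable: "(\<lambda>\<tau>. absolute_pgf z (max 0 (t - \<tau>))) \<in> borel_measurable borel"
proof -
  have [measurable]: "(\<lambda>\<tau>. position_mean (\<lambda>k. norm (z $ k)) j (max 0 (t - \<tau>))) \<in> borel_measurable borel" for j
    by (rule measurable_compose[OF _ position_mean_measurable]) measurable
  have "(\<lambda>w. ennreal (\<Prod>j\<in>UNIV. position_mean (\<lambda>k. norm (z $ k)) j (max 0 (t - fst w)) ^ (snd w $ j)))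
      \<in> borel_measurable (borel \<Otimes>\<^sub>M measure_pmf S)"
    by (rule measurable_compose_countable[where g=snd]) measurable
  then show ?thesis
    unfolding absolute_pgf_def
    by (intro measure_pmf.borel_measurable_nn_integral) (simp add: case_prod_beta')
qed

text \<open>The mean of a weight is at most the mean of its modulus, hence the generating function at the moduli of
the mixed arguments is at most the one at the mixed moduli.\<close>

lemma absolute_pgf_upper:
  assumes "0 \<le> u"
  shows "(\<integral>\<^sup>+s. ennreal (\<Prod>j\<in>UNIV. norm (mixed_arg q z u $ j) ^ (s $ j)) \<partial>S) \<le> absolute_pgf z u"
  unfolding absolute_pgf_def mixed_arg_eq_position_mean
  by (intro nn_integral_mono ennreal_leI prod_mono conjI power_mono norm_position_mean_le assms
      zero_le_power norm_ge_zero)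

lemma mixed_arg_in_pgf_domain:
  assumes "0 \<le> u" "absolute_pgf z u < \<infinity>"
  shows "mixed_arg q z u \<in> pgf_domain S"
  by (intro pgf_domainI le_less_trans[OF absolute_pgf_upper] assms)

lemma pgf_mixed_arg_measurable: "(\<lambda>\<tau>. pgf S (mixed_arg q z (max 0 (t - \<tau>)))) \<in> borel_measurable borel"
proof -
  have "(\<lambda>\<tau>. position_mean (($) z) j (max 0 (t - \<tau>))) \<in> borel_measurable borel" for j
    by (rule measurable_compose[OF _ position_mean_measurable]) measurable
  from pgf_measurable[OF this] show ?thesis
    by (simp add: mixed_arg_def position_mean_def)
qed

text \<open>The same two averaging steps for complex weights. The last hypothesis excludes, for almost every
outcome, points at which the mean factor of a batch does not exist: there the Bochner integral is \<open>0\<close>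
by convention and the product rule for independent factors may fail.\<close>

lemma customer_product_integral:
  fixes z :: "complex ^ 'n"
  assumes t: "0 \<le> t"
    and int: "integrable M (\<lambda>\<omega>. customer_product (($) z) t (\<lambda>i. T i \<omega>) (\<lambda>i. batch i \<omega>) (\<lambda>j i l. \<omega>))"
    and fin: "AE \<tau> in lborel. \<tau> \<in> {0..t} \<longrightarrow> rate \<tau> = 0 \<or> absolute_pgf z (max 0 (t - \<tau>)) < \<infinity>"
  shows "(LINT \<omega>|M. customer_product (($) z) t (\<lambda>i. T i \<omega>) (\<lambda>i. batch i \<omega>) (\<lambda>j i l. \<omega>)) =
    (LINT \<omega>|M. point_product (\<lambda>\<tau>. pgf S (mixed_arg q z (max 0 (t - \<tau>)))) t \<omega>)"
proof -
  let ?F = "\<lambda>\<omega> \<omega>'. customer_product (($) z) t (\<lambda>i. T i \<omega>) (\<lambda>i. batch i \<omega>) (\<lambda>j i l. \<omega>')"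
  let ?Q = "\<lambda>\<omega> \<omega>'. batch_product (position_mean (($) z)) t (\<lambda>i. T i \<omega>) (\<lambda>i. batch i \<omega>')"
  let ?h = "\<lambda>\<tau>. pgf S (mixed_arg q z (max 0 (t - \<tau>)))"
  have F_eq: "(LINT \<omega>|M. ?F \<omega> \<omega>) = (LINT \<omega>|M. LINT \<omega>'|M. ?F \<omega> \<omega>')"
    and F_int: "integrable M (\<lambda>\<omega>. LINT \<omega>'|M. ?F \<omega> \<omega>')"
    using indep_var_integral[OF routes_indep split_customer_product_measurable[OF t], of "($) z"] int
    by simp_all
  have Q_meas: "(\<lambda>\<omega>. ?Q \<omega> \<omega>) \<in> borel_measurable M"
    by (intro batch_product_measurable position_mean_measurable points_measurable batch_measurable)
  have FQ: "AE \<omega> in M. (LINT \<omega>'|M. ?F \<omega> \<omega>') = ?Q \<omega> \<omega>"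
    using points_locally_finite[of t]
  proof eventually_elim
    case (elim \<omega>)
    show ?case
      by (rule has_bochner_integral_integral_eq) (rule customer_product_route_integral[OF t elim])
  qed
  have Q_int: "integrable M (\<lambda>\<omega>. ?Q \<omega> \<omega>)"
    using F_int Q_meas FQ by (rule integrable_cong_AE_imp) 
  have Q_eq: "(LINT \<omega>|M. ?Q \<omega> \<omega>) = (LINT \<omega>|M. LINT \<omega>'|M. ?Q \<omega> \<omega>')"
    and Q_int': "integrable M (\<lambda>\<omega>. LINT \<omega>'|M. ?Q \<omega> \<omega>')"
    using indep_var_integral[OF batches_indep split_batch_product_measurable, of "($) z" t] Q_int
    by simp_all
  have "AE \<omega> in M. \<forall>i. T i \<omega> \<le> ereal t \<longrightarrow> absolute_pgf z (max 0 (t - real_of_ereal (T i \<omega>))) < \<infinity>"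
  proof (rule AE_points_avoid[OF _ t fin])
    show "{\<tau>. absolute_pgf z (max 0 (t - \<tau>)) < \<infinity>} \<in> sets borel"
      using absolute_pgf_measurable[of z t] by measurable
  qed
  then have "AE \<omega> in M. (LINT \<omega>'|M. ?Q \<omega> \<omega>') = point_product ?h t \<omega>"
    using points_locally_finite[of t]
  proof eventually_elim
    case (elim \<omega>)
    have "(LINT \<omega>'|M. ?Q \<omega> \<omega>') = (\<Prod>i\<in>{i. T i \<omega> \<le> ereal t}. LINT s|S. (\<Prod>j\<in>UNIV.
        position_mean (($) z) j (max 0 (t - real_of_ereal (T i \<omega>))) ^ (s $ j)))"
    proof (rule batch_product_integral[OF elim(2)])
      fix i assume "T i \<omega> \<le> ereal t"
      then have "mixed_arg q z (max 0 (t - real_of_ereal (T i \<omega>))) \<in> pgf_domain S"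
        using elim(1) by (intro mixed_arg_in_pgf_domain) auto
      then show "integrable S (\<lambda>s. \<Prod>j\<in>UNIV.
          position_mean (($) z) j (max 0 (t - real_of_ereal (T i \<omega>))) ^ (s $ j))"
        by (simp add: pgf_domain_def mixed_arg_eq_position_mean)
    qed
    then show ?case
      by (simp add: point_product_def pgf_def mixed_arg_eq_position_mean)
  qed
  moreover have "point_product ?h t \<in> borel_measurable M"
    by (intro point_product_measurable pgf_mixed_arg_measurable)
  ultimately have "(LINT \<omega>|M. LINT \<omega>'|M. ?Q \<omega> \<omega>') = (LINT \<omega>|M. point_product ?h t \<omega>)"
    using Q_int' by (intro Bochner_Integration.integral_cong_AE) auto
  moreover have "(LINT \<omega>|M. LINT \<omega>'|M. ?F \<omega> \<omega>') = (LINT \<omega>|M. ?Q \<omega> \<omega>)"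
    using F_int Q_meas FQ by (intro Bochner_Integration.integral_cong_AE) auto
  ultimately show ?thesis
    using F_eq Q_eq by simp
qed

lemma occupancy_pgf:
  fixes z :: "complex ^ 'n" and t :: real
  defines "F \<equiv> \<lambda>\<omega>. \<Prod>k\<in>UNIV. (z $ k) ^ (occupancy T batch X t \<omega> $ k)"
    and "R \<equiv> \<lambda>\<tau>. of_real (rate \<tau>) * (1 - pgf S (mixed_arg q z (t - \<tau>)))"
  assumes t: "0 \<le> t" and int: "integrable M F"
  shows "AE \<tau> in lborel. \<tau> \<in> {0..t} \<and> rate \<tau> \<noteq> 0 \<longrightarrow> mixed_arg q z (t - \<tau>) \<in> pgf_domain S"
    and "set_integrable lborel {0..t} R"
    and "(LINT \<omega>|M. F \<omega>) = exp (- (LBINT \<tau>:{0..t}. R \<tau>))"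
proof -
  let ?g = "\<lambda>\<tau>. absolute_pgf z (max 0 (t - \<tau>))"
  define h where "h \<tau> = pgf S (mixed_arg q z (max 0 (t - \<tau>)))" for \<tau>
  have h[measurable]: "h \<in> borel_measurable borel"
    unfolding h_def[abs_def] by (rule pgf_mixed_arg_measurable)
  have F: "F = (\<lambda>\<omega>. customer_product (($) z) t (\<lambda>i. T i \<omega>) (\<lambda>i. batch i \<omega>) (\<lambda>j i l. \<omega>))"
    unfolding F_def occupancy_eq_customer_product ..
  \<comment> \<open>The modulus of the occupancy product is the occupancy product of the moduli, so integrability of
    the former makes the intensity integral of \<open>?g\<close> finite.\<close>
  have "(\<integral>\<^sup>+\<omega>. point_product ?g t \<omega> \<partial>M) = (\<integral>\<^sup>+\<omega>. ennreal (norm (F \<omega>)) \<partial>M)"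
    using customer_product_nn_integral[OF t, of "\<lambda>k. norm (z $ k)"]
    by (simp add: F norm_customer_product absolute_pgf_def[abs_def])
  also have "\<dots> < \<infinity>"
    using int by (simp add: integrable_iff_bounded)
  finally have fin: "(\<integral>\<^sup>+\<tau>\<in>{0..t}. ennreal (rate \<tau>) * ?g \<tau> \<partial>lborel) < \<infinity>"
    by (rule set_nn_integral_rate_finite[OF absolute_pgf_measurable t])
  have "AE \<tau> in lborel. ennreal (rate \<tau>) * ?g \<tau> * indicator {0..t} \<tau> \<noteq> \<infinity>"
    using fin by (intro nn_integral_PInf_AE set_nn_integral_rate_measurable absolute_pgf_measurable) auto
  then have g_fin: "AE \<tau> in lborel. \<tau> \<in> {0..t} \<longrightarrow> rate \<tau> = 0 \<or> ?g \<tau> < \<infinity>"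
  proof eventually_elim
    case (elim \<tau>)
    show ?case
    proof
      assume \<tau>: "\<tau> \<in> {0..t}"
      then have "ennreal (rate \<tau>) * ?g \<tau> \<noteq> \<infinity>" using elim by simp
      then show "rate \<tau> = 0 \<or> ?g \<tau> < \<infinity>"
        using rate_nonneg[of \<tau>] \<tau> by (auto simp: ennreal_mult_eq_top_iff less_top)
    qed
  qed
  then show "AE \<tau> in lborel. \<tau> \<in> {0..t} \<and> rate \<tau> \<noteq> 0 \<longrightarrow> mixed_arg q z (t - \<tau>) \<in> pgf_domain S"
  proof eventually_elim
    case (elim \<tau>)
    then show ?case
      using mixed_arg_in_pgf_domain[of "t - \<tau>" z] by (auto simp: max_def split: if_splits)
  qed
  have int_h: "set_integrable lborel {0..t} (\<lambda>\<tau>. of_real (rate \<tau>) * h \<tau>)"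
    unfolding set_integrable_def
  proof (rule integrableI_bounded)
    have [measurable]: "(\<lambda>\<tau>. indicator {0..t} \<tau> *\<^sub>R rate \<tau>) \<in> borel_measurable lborel"
      using rate_integrable[of t] unfolding set_integrable_def by (rule borel_measurable_integrable)
    have "(\<lambda>\<tau>. complex_of_real (indicator {0..t} \<tau> *\<^sub>R rate \<tau>) * h \<tau>) \<in> borel_measurable lborel"
      by measurable
    then show "(\<lambda>\<tau>. indicator {0..t} \<tau> *\<^sub>R (complex_of_real (rate \<tau>) * h \<tau>)) \<in> borel_measurable lborel"
      by (simp add: scaleR_conv_of_real mult.assoc)
    have "ennreal (norm (indicator {0..t} \<tau> *\<^sub>R (complex_of_real (rate \<tau>) * h \<tau>))) \<le>
        ennreal (rate \<tau>) * ?g \<tau> * indicator {0..t} \<tau>" for \<tau>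
    proof (cases "\<tau> \<in> {0..t}")
      case True
      have "ennreal (norm (h \<tau>)) \<le> ?g \<tau>"
        unfolding h_def by (rule order_trans[OF norm_pgf_le absolute_pgf_upper]) simp
      then show ?thesis
        using True rate_nonneg[of \<tau>] by (auto simp: norm_mult ennreal_mult intro!: mult_left_mono)
    qed simp
    then have "(\<integral>\<^sup>+\<tau>. ennreal (norm (indicator {0..t} \<tau> *\<^sub>R (complex_of_real (rate \<tau>) * h \<tau>))) \<partial>lborel)
        \<le> (\<integral>\<^sup>+\<tau>\<in>{0..t}. ennreal (rate \<tau>) * ?g \<tau> \<partial>lborel)"
      by (rule nn_integral_mono)
    then show "(\<integral>\<^sup>+\<tau>. ennreal (norm (indicator {0..t} \<tau> *\<^sub>R (complex_of_real (rate \<tau>) * h \<tau>))) \<partial>lborel) < \<infinity>"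
      using fin by (rule le_less_trans)
  qed
  have R: "indicator {0..t} \<tau> *\<^sub>R R \<tau> =
      complex_of_real (indicator {0..t} \<tau> *\<^sub>R rate \<tau>) - indicator {0..t} \<tau> *\<^sub>R (of_real (rate \<tau>) * h \<tau>)" for \<tau>
    by (cases "\<tau> \<in> {0..t}") (simp_all add: R_def h_def algebra_simps)
  show "set_integrable lborel {0..t} R"
    using rate_integrable[of t] int_h unfolding set_integrable_def R
    by (intro Bochner_Integration.integrable_diff integrable_of_real)
  have "(LINT \<omega>|M. F \<omega>) = (LINT \<omega>|M. point_product h t \<omega>)"
    using customer_product_integral[OF t int[unfolded F] g_fin] by (simp add: F h_def[abs_def])
  also have "\<dots> = exp (LBINT \<tau>:{0..t}. of_real (rate \<tau>) * (h \<tau> - 1))"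
    by (rule point_product_integral(2)[OF h t int_h])
  also have "(LBINT \<tau>:{0..t}. of_real (rate \<tau>) * (h \<tau> - 1)) = (LBINT \<tau>:{0..t}. - R \<tau>)"
    by (intro set_lebesgue_integral_cong) (auto simp: R_def h_def algebra_simps)
  also have "\<dots> = - (LBINT \<tau>:{0..t}. R \<tau>)"
    by (simp add: set_lebesgue_integral_def)
  finally show "(LINT \<omega>|M. F \<omega>) = exp (- (LBINT \<tau>:{0..t}. R \<tau>))" .
qed

end

theorem theorem3p1:
  fixes M :: "'a measure" and S :: "(nat ^ 'n) pmf" and D :: "(complex ^ 'n) set"
  assumes "batch_network M rate T S batch X q"
    and "unit_polydisc \<subseteq> D" and "D \<subseteq> pgf_domain S"
    and "0 \<le> t" and "z \<in> D"
  defines "F \<equiv> \<lambda>\<omega>. \<Prod>j\<in>UNIV. (z $ j) ^ (occupancy T batch X t \<omega> $ j)"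
    and "R \<equiv> \<lambda>\<tau>. of_real (rate \<tau>) * (1 - pgf S (mixed_arg q z (t - \<tau>)))"
  shows "(z \<in> unit_polydisc \<longrightarrow> integrable M F) \<and>
    (integrable M F \<longrightarrow>
      (AE \<tau> in lborel. \<tau> \<in> {0..t} \<and> rate \<tau> \<noteq> 0 \<longrightarrow> mixed_arg q z (t - \<tau>) \<in> pgf_domain S) \<and>
      set_integrable lborel {0..t} R \<and>
      (LINT \<omega>|M. F \<omega>) = exp (- (LBINT \<tau>:{0..t}. R \<tau>)))"
proof -
  interpret batch_network M rate T S batch X q by fact
  show ?thesis
    unfolding F_def R_def
    using integrable_unit_polydisc[OF \<open>0 \<le> t\<close>, of z] occupancy_pgf[OF \<open>0 \<le> t\<close>, of z] by blast
qed

end
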